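(* Let $\beta\in\mathbb{R}$. If $f\in\mathcal{A}$ satisfies $$1+\beta\frac{zf'(z)}{f(z)}\left(1-\frac{zf'(z)}{f(z)}+\frac{zf''(z)}{f'(z)}\right)\prec\varphi_{Ne}(z)=1+z-\frac{z^3}{3},$$ then (a) $f\in\mathcal{S}^*(z+\sqrt{1+z^2})$ whenever $\beta\geq\frac{8}{9(2-\sqrt{2})}$. (b) $f\in\mathcal{S}^*_C$ whenever $\beta\geq\frac{4}{3}$. (c) $f\in\mathcal{S}^*_{lim}$ whenever $\beta\geq\frac{16}{9(2\sqrt{2}-1)}$. (d) $f\in\mathcal{S}^*_{e}$ whenever $\beta\geq\frac{8e}{9(e-1)}$. (e) $f\in\mathcal{S}^*_{S}$ whenever $\beta\geq\frac{8}{9\sin1}$. (f) $f\in\mathcal{S}^*_{R}$ whenever $\beta\geq\frac{8}{9}(3+2\sqrt{2})$. (g) $f\in\mathcal{S}^*_{Ne}$ whenever $\beta\geq\frac{4}{3}$. The bounds on $\beta$ are best possible, i.e. in each part the lower bound on $\beta$ cannot be replaced by a smaller number.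
   Context: $\mathbb{D}$ is the open unit disk. $\mathcal{A}$ is the set of analytic functions $f$ on $\mathbb{D}$ with $f(0)=0$ and $f'(0)=1$. For analytic $f,g$ on $\mathbb{D}$, $f\prec g$ means there is an analytic $w$ on $\mathbb{D}$ with $w(0)=0$, $|w(z)|<1$ and $f(z)=g(w(z))$ on $\mathbb{D}$; the left-hand side of the hypothesis is understood to be analytic on $\mathbb{D}$ (after removing removable singularities). For analytic $\varphi$ with $\varphi(0)=1$, $\mathcal{S}^*(\varphi)=\{f\in\mathcal{A}: zf'(z)/f(z)\prec\varphi(z)\}$. Then $\mathcal{S}^*_C=\mathcal{S}^*(1+\frac43z+\frac23z^2)$, $\mathcal{S}^*_{lim}=\mathcal{S}^*(1+\sqrt2z+\frac12z^2)$, $\mathcal{S}^*_e=\mathcal{S}^*(e^z)$, $\mathcal{S}^*_S=\mathcal{S}^*(1+\sin z)$, $\mathcal{S}^*_R=\mathcal{S}^*\left(1+\frac{z}{k}\frac{k+z}{k-z}\right)$ with $k=1+\sqrt2$, and $\mathcal{S}^*_{Ne}=\mathcal{S}^*(1+z-z^3/3)$. The principal branch of the square root is used. *)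

theory Defs
  imports "HOL-Complex_Analysis.Complex_Analysis"
begin

abbreviation unit_disc :: "complex set" where
  "unit_disc \<equiv> ball 0 1"

(* Functions are total in HOL; only the values on the unit disc matter. *)
definition class_A :: "(complex \<Rightarrow> complex) set" where
  "class_A = {f. f holomorphic_on unit_disc \<and> f 0 = 0 \<and> deriv f 0 = 1}"

definition subordinate :: "(complex \<Rightarrow> complex) \<Rightarrow> (complex \<Rightarrow> complex) \<Rightarrow> bool"
    (infix "\<prec>\<^sub>D" 50) where
  "f \<prec>\<^sub>D g \<longleftrightarrow>
     f holomorphic_on unit_disc \<and> g holomorphic_on unit_disc \<and>
     (\<exists>w. w holomorphic_on unit_disc \<and> w 0 = 0 \<and>
          (\<forall>z\<in>unit_disc. norm (w z) < 1 \<and> f z = g (w z)))"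

(* Quotients such as z f'(z)/f(z) are read after removing removable singularities
   (z = 0 is always one), hence remove_sings. It maps a pole to the junk value 0, where the
   result is discontinuous; a function with a pole in the disc thus fails the
   holomorphy requirement in subordinate. *)
definition starlike_class :: "(complex \<Rightarrow> complex) \<Rightarrow> (complex \<Rightarrow> complex) set" where
  "starlike_class \<phi> =
     {f \<in> class_A. remove_sings (\<lambda>z. z * deriv f z / f z) \<prec>\<^sub>D \<phi>}"

definition beta_expr :: "real \<Rightarrow> (complex \<Rightarrow> complex) \<Rightarrow> complex \<Rightarrow> complex" where
  "beta_expr \<beta> f =
     remove_sings (\<lambda>z. 1 + of_real \<beta> * (z * deriv f z / f z) *
       (1 - z * deriv f z / f z + z * deriv (deriv f) z / deriv f z))"

definition phi_Ne :: "complex \<Rightarrow> complex" where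
  "phi_Ne z = 1 + z - z ^ 3 / 3"

definition phi_crescent :: "complex \<Rightarrow> complex" where
  "phi_crescent z = z + csqrt (1 + z ^ 2)"

definition phi_C :: "complex \<Rightarrow> complex" where
  "phi_C z = 1 + 4 / 3 * z + 2 / 3 * z ^ 2"

definition phi_lim :: "complex \<Rightarrow> complex" where
  "phi_lim z = 1 + of_real (sqrt 2) * z + 1 / 2 * z ^ 2"

definition phi_sin :: "complex \<Rightarrow> complex" where
  "phi_sin z = 1 + sin z"

definition phi_R :: "complex \<Rightarrow> complex" where
  "phi_R z = (let k = of_real (1 + sqrt 2) in 1 + z / k * ((k + z) / (k - z)))"

abbreviation starlike_C :: "(complex \<Rightarrow> complex) set" where
  "starlike_C \<equiv> starlike_class phi_C"

abbreviation starlike_lim :: "(complex \<Rightarrow> complex) set" where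
  "starlike_lim \<equiv> starlike_class phi_lim"

abbreviation starlike_e :: "(complex \<Rightarrow> complex) set" where
  "starlike_e \<equiv> starlike_class exp"

abbreviation starlike_S :: "(complex \<Rightarrow> complex) set" where
  "starlike_S \<equiv> starlike_class phi_sin"

abbreviation starlike_R :: "(complex \<Rightarrow> complex) set" where
  "starlike_R \<equiv> starlike_class phi_R"

abbreviation starlike_Ne :: "(complex \<Rightarrow> complex) set" where
  "starlike_Ne \<equiv> starlike_class phi_Ne"

end

(* Writing p = z f'/f, the expression in the hypothesis is 1 + \<beta> z p', so \<beta> z p' = h(w) with
   h(z) = z - z^3/3 and a Schwarz function w. As h is starlike and h(z) = z k'(z) for
   k(z) = z - z^3/9, Jack's lemma applied to k^(-1)(\<beta> (p - 1)) shows that p takes its values in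
   q(D), where q = 1 + k/\<beta>. It remains to compare q(D) with \<phi>(D). If \<delta> = 1 - \<phi>(-1), the condition
   \<beta> \<ge> 8/(9 \<delta>) says q(-1) \<ge> \<phi>(-1). It is necessary because f with z f'/f = q is admissible, and
   sufficient because the boundary curve of \<phi>(D) stays outside an explicit region containing q(D). *)

theory Submission
  imports Defs
begin

section \<open>The nephroid and Jack's lemma\<close>

text \<open>The comparison of q(D) with \<phi>(D) leaves little room. As k(1) = 8/9 but norm (k(i))
  = 10/9, a disc about 0 that contains the oval k(D) is too large to be compatible with \<phi>(-1) -
  1 = -\<delta> at the critical \<beta>. The strip abs x < 8/9 contains the oval too, and for five
  of the seven targets every boundary point leaves the rescaled strip or the rescaled disc. The
  exponential does not: with u = 1 + Re \<zeta>, its real part exceeds the extremal value by about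
  u^2 / (6 e), while y^2 is of order u. Hence its boundary curve bends into the strip to the order
  y^4, and so does the oval. This suggests a region A abs x + B y^4 < D. For A = (8/9)^3 the choice
  B = 3/10 is a compromise: it is large enough for exp and sin, whereas 1/3 would already exclude
  points of the oval. The disc remains as a second test, for boundary points far from the extremal
  one.\<close>

definition nephroid :: "complex \<Rightarrow> complex" where
  "nephroid z = z - z ^ 3 / 3"

text \<open>This is k of the overview, and \<open>nephroid\<close> is h.\<close>

definition oval :: "complex \<Rightarrow> complex" where
  "oval z = z - z ^ 3 / 9"

text \<open>Isolating \<open>P\<close> separates what survives on the unit circle from the terms
  with the factor \<open>1 - P\<close>. The case \<open>P = 1\<close> yields the sextic, and
  \<open>P = 1 - d\<close> measures the defect inside the disc.\<close>

lemma nephroid_parts: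
  assumes "P = (norm u)\<^sup>2"
  shows "(norm (nephroid u))\<^sup>2 - 4 / 9 =
      4 / 3 * P * (Im u)\<^sup>2 - (1 - P)\<^sup>2 * (4 - P) / 9"
    and "(Im (nephroid u))\<^sup>2 = (Im u)\<^sup>2 * (1 - P + 4 / 3 * (Im u)\<^sup>2)\<^sup>2"
proof -
  have P: "P = (Re u)\<^sup>2 + (Im u)\<^sup>2"
    using assms by (simp add: cmod_power2)
  have re: "Re (nephroid u) = Re u - ((Re u) ^ 3 - 3 * Re u * (Im u)\<^sup>2) / 3"
    by (simp add: nephroid_def power3_eq_cube power2_eq_square algebra_simps)
  have im: "Im (nephroid u) = Im u - (3 * (Re u)\<^sup>2 * Im u - (Im u) ^ 3) / 3"
    by (simp add: nephroid_def power3_eq_cube power2_eq_square algebra_simps)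
  show "(norm (nephroid u))\<^sup>2 - 4 / 9 =
      4 / 3 * P * (Im u)\<^sup>2 - (1 - P)\<^sup>2 * (4 - P) / 9"
    unfolding cmod_power2 re im P by (simp add: field_simps) algebra
  show "(Im (nephroid u))\<^sup>2 = (Im u)\<^sup>2 * (1 - P + 4 / 3 * (Im u)\<^sup>2)\<^sup>2"
    unfolding im P by (simp add: field_simps) algebra
qed

text \<open>The image of the unit circle is the sextic \<open>(x\<^sup>2 + y\<^sup>2 - 4/9)\<^sup>3 = 4/3 * y\<^sup>2\<close>; comparing degrees
  under scaling shows that its exterior is closed under multiplication by \<open>L \<ge> 1\<close>.\<close>

lemma nephroid_inside:
  assumes "norm u < 1"
  shows "((norm (nephroid u))\<^sup>2 - 4 / 9) ^ 3 < 4 / 3 * (Im (nephroid u))\<^sup>2"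
proof -
  \<comment> \<open>For \<open>d = 0\<close> both sides of the claim are \<open>Y ^ 3\<close>. For
    \<open>d > 0\<close> the base \<open>B\<close> on the left falls below \<open>Y\<close>, while
    the right side \<open>Y * (d + Y)\<^sup>2\<close> does not decrease.\<close>
  define d where "d = 1 - (norm u)\<^sup>2"
  define Y where "Y = 4 / 3 * (Im u)\<^sup>2"
  define B where "B = (1 - d) * Y - d\<^sup>2 * (3 + d) / 9"
  have d: "0 < d" "d \<le> 1"
    using assms by (auto simp: d_def abs_square_less_1)
  have Y: "0 \<le> Y"
    by (simp add: Y_def)
  have B_eq: "(norm (nephroid u))\<^sup>2 - 4 / 9 = B"
    using nephroid_parts(1)[of "1 - d" u] by (simp add: d_def B_def Y_def)
  have rhs: "4 / 3 * (Im (nephroid u))\<^sup>2 = Y * (d + Y)\<^sup>2"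
    using nephroid_parts(2)[of "1 - d" u] by (simp add: d_def Y_def)
  have pos: "0 < d\<^sup>2 * (3 + d) / 9" using d by simp
  have "(1 - d) * Y \<le> Y"
    using d Y by (simp add: mult_left_le_one_le)
  hence BY: "B < Y" using pos by (simp add: B_def)
  have "B ^ 3 < Y * (d + Y)\<^sup>2"
  proof (cases "B < 0")
    case True
    hence "B ^ 3 < 0" by simp
    moreover have "0 \<le> Y * (d + Y)\<^sup>2" using Y by simp
    ultimately show ?thesis by linarith
  next
    case False
    hence "B ^ 3 < Y ^ 3" using BY by (intro power_strict_mono) auto
    also have "\<dots> = Y * Y\<^sup>2" by (simp add: power2_eq_square power3_eq_cube)
    also have "\<dots> \<le> Y * (d + Y)\<^sup>2"
      using Y d by (intro mult_left_mono power_mono) auto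
    finally show ?thesis .
  qed
  thus ?thesis by (simp only: B_eq rhs)
qed

lemma nephroid_boundary:
  assumes "norm u = 1"
  shows "((norm (nephroid u))\<^sup>2 - 4 / 9) ^ 3 = 4 / 3 * (Im (nephroid u))\<^sup>2"
proof -
  have *: "(norm (nephroid u))\<^sup>2 - 4 / 9 = 4 / 3 * (Im u)\<^sup>2"
    "(Im (nephroid u))\<^sup>2 = (Im u)\<^sup>2 * (4 / 3 * (Im u)\<^sup>2)\<^sup>2"
    using nephroid_parts[of 1 u] assms by simp_all
  show ?thesis
    unfolding * by (simp add: power2_eq_square power3_eq_cube)
qed

text \<open>The starlikeness of h is used in exactly this form: it refutes the equation that Jack's
  lemma produces at a point where P would leave the oval.\<close>

lemma nephroid_starlike:
  assumes "norm u < 1" "norm \<zeta> = 1" "1 \<le> L"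
  shows "nephroid u \<noteq> of_real L * nephroid \<zeta>"
proof
  assume eq: "nephroid u = of_real L * nephroid \<zeta>"
  define r where "r = (norm (nephroid \<zeta>))\<^sup>2 - 4 / 9"
  define t where "t = (Im (nephroid \<zeta>))\<^sup>2"
  have rt: "r ^ 3 = 4 / 3 * t"
    using nephroid_boundary[OF assms(2)] by (simp add: r_def t_def)
  have t: "0 \<le> t" by (simp add: t_def)
  have "0 \<le> r ^ 3" unfolding rt using t by simp
  hence r: "0 \<le> r" by (metis zero_le_odd_power odd_numeral)
  have L: "1 \<le> L\<^sup>2" using assms(3) by simp
  have "L\<^sup>2 * (4 / 3 * t) \<le> (L\<^sup>2) ^ 3 * r ^ 3"
    unfolding rt using L t by (intro mult_right_mono self_le_power) auto
  also have "\<dots> = (L\<^sup>2 * r) ^ 3" by (simp add: power_mult_distrib)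
  also have "\<dots> \<le> (L\<^sup>2 * (r + 4 / 9) - 4 / 9) ^ 3"
    using L r by (intro power_mono) (auto simp: algebra_simps)
  also have "L\<^sup>2 * (r + 4 / 9) = (norm (nephroid u))\<^sup>2"
    by (simp add: eq r_def norm_mult power_mult_distrib)
  also have "((norm (nephroid u))\<^sup>2 - 4 / 9) ^ 3 < 4 / 3 * (Im (nephroid u))\<^sup>2"
    by (rule nephroid_inside[OF assms(1)])
  also have "(Im (nephroid u))\<^sup>2 = L\<^sup>2 * t"
    by (simp add: eq t_def power_mult_distrib)
  finally show False by simp
qed

text \<open>The radius exceeds 1 so that the inverse of \<open>oval\<close> is holomorphic around
  boundary values \<open>oval \<zeta>\<close>, where Jack's lemma differentiates it. The bound
  behind it is 3 (3/2)^2 = 27/4 < 9.\<close>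

lemma inj_on_oval: "inj_on oval (ball 0 (3 / 2))"
proof (rule inj_onI)
  fix a b :: complex
  assume a: "a \<in> ball 0 (3 / 2)" and b: "b \<in> ball 0 (3 / 2)" and eq: "oval a = oval b"
  have "norm (a\<^sup>2 + a * b + b\<^sup>2) \<le> norm a ^ 2 + norm a * norm b + norm b ^ 2"
    by (metis (no_types, lifting) norm_add_rule_thm norm_mult norm_power order.refl)
  also have "\<dots> \<le> (3 / 2)\<^sup>2 + 3 / 2 * (3 / 2) + (3 / 2)\<^sup>2"
    using a b by (intro add_mono power_mono mult_mono) auto
  also have "\<dots> < 9" by (simp add: power2_eq_square)
  finally have "a\<^sup>2 + a * b + b\<^sup>2 \<noteq> 9" by auto
  moreover have "(a - b) * (9 - (a\<^sup>2 + a * b + b\<^sup>2)) = 9 * (oval a - oval b)"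
    by (simp add: oval_def field_simps power2_eq_square power3_eq_cube)
  ultimately show "a = b" using eq by simp
qed

text \<open>Testing the Schwarz bound on the segments that leave \<open>z0\<close> in the directions
  \<open>v * z0\<close> with \<open>Re v < 0\<close> gives \<open>Re (v * (L - 1)) \<le> 0\<close> for all such \<open>v\<close>.\<close>

lemma Jack:
  fixes \<omega> :: "complex \<Rightarrow> complex"
  assumes holo: "\<omega> holomorphic_on ball 0 r" and r: "0 < r" and \<omega>0: "\<omega> 0 = 0"
    and lt: "\<And>z. norm z < r \<Longrightarrow> norm (\<omega> z) < 1"
    and z0: "norm z0 = r" and deriv: "(\<omega> has_field_derivative \<omega>') (at z0)"
    and \<omega>z0: "norm (\<omega> z0) = 1"
  obtains L where "1 \<le> L" "z0 * \<omega>' = of_real L * \<omega> z0"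
proof -
  have schwarz: "norm (\<omega> z) \<le> norm z / r" if "norm z < r" for z
  proof -
    have "norm (\<omega> (of_real r * (z / of_real r))) \<le> norm (z / of_real r)"
    proof (rule Schwarz_Lemma(1)[where f = "\<lambda>z. \<omega> (of_real r * z)"])
      have "(\<omega> \<circ> (*) (of_real r)) holomorphic_on ball 0 1"
        by (intro holomorphic_on_compose holomorphic_on_subset[OF holo] holomorphic_intros)
          (use r in \<open>auto simp: norm_mult\<close>)
      thus "(\<lambda>z. \<omega> (of_real r * z)) holomorphic_on ball 0 1"
        by (simp add: o_def)
    qed (use r \<omega>0 that in \<open>auto intro!: lt simp: norm_mult norm_divide\<close>)
    thus ?thesis using r by (simp add: norm_divide)
  qed
  define M where "M = z0 * \<omega>' / \<omega> z0"
  have nz: "\<omega> z0 \<noteq> 0" using \<omega>z0 by auto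
  have key: "Re (v * (M - 1)) \<le> 0" if v: "Re v < 0" for v
  proof -
    \<comment> \<open>Schwarz gives \<open>g t \<le> 0\<close> as long as \<open>1 + t v\<close>
      stays in the unit disc, and \<open>g 0 = 0\<close>, so the derivative of \<open>g\<close> at 0
      cannot be positive. Squared norms keep \<open>g\<close> differentiable.\<close>
    define g where "g t = norm (\<omega> (z0 * (1 + of_real t * v))) ^ 2 - norm (1 + of_real t * v) ^ 2" for t
    have d1: "((\<lambda>t. \<omega> (z0 * (1 + of_real t * v))) has_vector_derivative (z0 * v * \<omega>')) (at 0)"
    proof -
      have "((\<lambda>t. z0 * (1 + of_real t * v)) has_vector_derivative (z0 * v)) (at 0)"
        by (auto intro!: derivative_eq_intros)
      moreover have "(\<omega> has_field_derivative \<omega>') (at (z0 * (1 + of_real 0 * v)))"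
        using deriv by simp
      ultimately show ?thesis
        using field_vector_diff_chain_at[of "\<lambda>t. z0 * (1 + of_real t * v)" "z0 * v" 0 \<omega> \<omega>'] by (simp add: o_def)
    qed
    have d2: "((\<lambda>t. 1 + of_real t * v) has_vector_derivative v) (at (0::real))"
      by (auto intro!: derivative_eq_intros)
    have sq: "((\<lambda>t. norm (F t) ^ 2) has_real_derivative 2 * Re (cnj (F 0) * F')) (at 0)"
      if "(F has_vector_derivative F') (at 0)" for F :: "real \<Rightarrow> complex" and F'
    proof -
      have "((\<lambda>t. F t \<bullet> F t) has_derivative (\<lambda>h. F 0 \<bullet> (h *\<^sub>R F') + (h *\<^sub>R F') \<bullet> F 0)) (at 0)"
        using that unfolding has_vector_derivative_def
        by (intro has_derivative_inner)
      hence "((\<lambda>t. F t \<bullet> F t) has_derivative (*) (2 * Re (cnj (F 0) * F'))) (at 0)"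
        by (rule has_derivative_eq_rhs) (auto simp: fun_eq_iff inner_complex_def algebra_simps)
      thus ?thesis by (simp add: has_field_derivative_def power2_norm_eq_inner)
    qed
    have "(g has_real_derivative
        2 * Re (cnj (\<omega> (z0 * (1 + of_real 0 * v))) * (z0 * v * \<omega>')) - 2 * Re (cnj (1 + of_real 0 * v) * v)) (at 0)"
      unfolding g_def by (intro DERIV_diff sq d1 d2)
    moreover have "cnj (\<omega> z0) * (z0 * v * \<omega>') = v * M"
    proof -
      have "cnj (\<omega> z0) * (z0 * v * \<omega>') = (\<omega> z0 * cnj (\<omega> z0)) * (v * M)"
        using nz by (simp add: M_def)
      also have "\<omega> z0 * cnj (\<omega> z0) = 1"
        using \<omega>z0 complex_norm_square[of "\<omega> z0"] by simp
      finally show ?thesis by simp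
    qed
    moreover have "v * (M - 1) = v * M - v" by (simp add: algebra_simps)
    ultimately have dg: "(g has_real_derivative 2 * Re (v * (M - 1))) (at 0)"
      by (simp only: of_real_0 mult_zero_left add_0_right mult_1_right complex_cnj_one mult_1_left
        minus_complex.sel right_diff_distrib)
    have g0: "g 0 = 0" by (simp add: g_def \<omega>z0)
    show ?thesis
    proof (rule ccontr)
      assume "\<not> ?thesis"
      then obtain e where e: "e > 0" "\<And>h. 0 < h \<Longrightarrow> h < e \<Longrightarrow> g 0 < g (0 + h)"
        using DERIV_pos_inc_right[OF dg] by auto
      \<comment> \<open>The segment stays in the disc for \<open>t\<close> below -2 Re v / (norm
        v)^2; half of this bound is taken.\<close>
      define t where "t = min (e / 2) (- Re v / (norm v)\<^sup>2)"
      have vn: "norm v > 0" using v by auto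
      have "Re v / (norm v)\<^sup>2 < 0" using v vn by (intro divide_neg_pos) auto
      hence t: "0 < t" "t < e" using e by (auto simp: t_def)
      have "norm (1 + of_real t * v) ^ 2 = 1 + t * (2 * Re v + t * (norm v)\<^sup>2)"
        by (simp only: cmod_power2) (simp add: power2_eq_square algebra_simps)
      also have "\<dots> < 1"
      proof -
        have "t * (norm v)\<^sup>2 \<le> - Re v"
          using vn by (simp add: t_def min_def field_simps split: if_splits)
        hence "2 * Re v + t * (norm v)\<^sup>2 < 0" using v by linarith
        thus ?thesis using t by (simp add: mult_pos_neg)
      qed
      finally have n1: "norm (1 + of_real t * v) < 1"
        by (simp add: abs_square_less_1)
      have "norm (\<omega> (z0 * (1 + of_real t * v))) \<le> norm (z0 * (1 + of_real t * v)) / r"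
        using n1 r z0 by (intro schwarz) (simp add: norm_mult)
      also have "\<dots> = norm (1 + of_real t * v)"
        using r z0 by (simp add: norm_mult)
      finally have "g t \<le> 0"
        by (simp add: g_def power_mono)
      thus False using e(2)[OF t] g0 by simp
    qed
  qed
  have re: "1 \<le> Re M"
    using key[of "-1"] by simp
  have "Im M = 0"
  proof (rule ccontr)
    assume "Im M \<noteq> 0"
    \<comment> \<open>With this slope, \<open>v = -1 + \<i> s\<close> gives Re (v (M - 1)) = 1 - Re
      M - s Im M = 1 > 0, against \<open>key\<close>.\<close>
    define s where "s = - (Re M) / Im M"
    have "s * Im M = - Re M" using \<open>Im M \<noteq> 0\<close> by (simp add: s_def)
    moreover have "Re (Complex (-1) s * (M - 1)) \<le> 0" by (intro key) simp
    ultimately show False by simp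
  qed
  hence "M = of_real (Re M)" by (simp add: complex_eq_iff)
  moreover have "z0 * \<omega>' = M * \<omega> z0" using nz by (simp add: M_def)
  ultimately show ?thesis using re that by metis
qed

section \<open>The values of P lie in the oval\<close>

lemma holomorphic_oval [holomorphic_intros]:
  "f holomorphic_on A \<Longrightarrow> (\<lambda>z. oval (f z)) holomorphic_on A"
  unfolding oval_def by (intro holomorphic_intros) auto

lemma continuous_on_oval [continuous_intros]:
  "continuous_on A f \<Longrightarrow> continuous_on A (\<lambda>z. oval (f z))"
  unfolding oval_def by (intro continuous_intros) auto

lemma has_field_derivative_oval:
  "(oval has_field_derivative (1 - z\<^sup>2 / 3)) (at z)"
  unfolding oval_def by (auto intro!: derivative_eq_intros simp: power2_eq_square)

lemma open_oval_image: "open (oval ` ball 0 1)"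
  by (intro open_mapping_thm3 holomorphic_intros inj_on_subset[OF inj_on_oval])
    (auto intro!: holomorphic_intros)

lemma oval_inverse:
  obtains h where "h holomorphic_on (oval ` ball 0 (3 / 2))"
    "\<And>z. norm z < 3 / 2 \<Longrightarrow> h (oval z) = z"
    "open (oval ` ball 0 (3 / 2))"
proof -
  have holo: "oval holomorphic_on ball 0 (3 / 2)"
    using holomorphic_oval[of "\<lambda>z. z"] by simp
  obtain h where "h holomorphic_on (oval ` ball 0 (3 / 2))"
    "\<And>z. z \<in> ball 0 (3 / 2) \<Longrightarrow> h (oval z) = z"
    using holomorphic_has_inverse[OF holo open_ball inj_on_oval] by metis
  moreover have "open (oval ` ball 0 (3 / 2))"
    by (intro open_mapping_thm3 holo inj_on_oval open_ball)
  ultimately show ?thesis using that by simp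
qed

text \<open>At a point of least modulus where \<open>P\<close> leaves \<open>oval ` ball 0 1\<close>, Jack's lemma for
  \<open>\<omega> = oval\<inverse> \<circ> P\<close> gives \<open>nephroid (w z0) = L * nephroid \<zeta>\<close> with \<open>L \<ge> 1\<close> and \<open>norm \<zeta> = 1\<close>,
  because \<open>\<zeta> * oval' \<zeta> = nephroid \<zeta>\<close>.\<close>

lemma image_subset_oval:
  assumes holo: "P holomorphic_on ball 0 1" and P0: "P 0 = 0"
    and w: "\<And>z. norm z < 1 \<Longrightarrow> norm (w z) < 1"
    and ode: "\<And>z. norm z < 1 \<Longrightarrow> z * deriv P z = nephroid (w z)"
  shows "P ` ball 0 1 \<subseteq> oval ` ball 0 1"
proof (rule ccontr)
  assume "\<not> ?thesis"
  then obtain z1 where "z1 \<in> ball 0 1" and "P z1 \<notin> oval ` ball 0 1" by blast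
  hence z1: "norm z1 < 1" "P z1 \<notin> oval ` ball 0 1" by simp_all
  have contP: "continuous_on A P" if "A \<subseteq> ball 0 1" for A
    using holomorphic_on_imp_continuous_on[OF holo] continuous_on_subset that by blast
  \<comment> \<open>The exit points are collected in a closed ball inside the open disc, which makes
    \<open>S\<close> compact although nothing is known about \<open>P\<close> near the unit
    circle.\<close>
  define S where "S = {z \<in> cball 0 (norm z1). P z \<in> - oval ` ball 0 1}"
  have subball: "cball 0 (norm z1) \<subseteq> (ball 0 1 :: complex set)" using z1 by auto
  have "closed S"
    unfolding S_def using subball continuous_closed_preimage[OF contP[of "cball 0 (norm z1)"] closed_cball, of "- oval ` ball 0 1"]
      open_oval_image z1 by (auto simp: closed_Compl vimage_def Int_def)
  moreover have "S \<subseteq> cball 0 (norm z1)" by (auto simp: S_def)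
  ultimately have "compact S"
    by (meson bounded_cball bounded_subset compact_eq_bounded_closed)
  moreover have "S \<noteq> {}" using z1 by (auto simp: S_def)
  ultimately obtain z0 where z0: "z0 \<in> S" and min: "\<And>y. y \<in> S \<Longrightarrow> norm z0 \<le> norm y"
    using continuous_attains_inf[of S norm] continuous_on_norm_id by blast
  define r where "r = norm z0"
  have r1: "r < 1" using z0 z1 by (auto simp: S_def r_def)
  have Pz0: "P z0 \<notin> oval ` ball 0 1" using z0 by (auto simp: S_def)
  have "z0 \<noteq> 0"
  proof
    assume "z0 = 0"
    moreover have "oval 0 = 0" by (simp add: oval_def)
    ultimately show False using Pz0 P0 by (metis centre_in_ball image_eqI zero_less_one)
  qed
  hence r0: "0 < r" by (simp add: r_def)
  have inside: "P z \<in> oval ` ball 0 1" if "norm z < r" for z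
  proof (rule ccontr)
    assume "P z \<notin> oval ` ball 0 1"
    moreover have "norm z \<le> norm z1" using that z0 by (auto simp: S_def r_def)
    ultimately have "z \<in> S" by (auto simp: S_def)
    from min[OF this] that show False by (simp add: r_def)
  qed
  \<comment> \<open>By minimality of \<open>norm z0\<close>, \<open>P z0\<close> is a limit of
    values in the open oval. As it is not in the oval itself, it equals \<open>oval \<zeta>\<close>
    with \<open>norm \<zeta> = 1\<close>.\<close>
  have "closed (oval ` cball 0 1)"
    by (intro compact_imp_closed compact_continuous_image continuous_intros compact_cball)
  hence "closure (oval ` ball 0 1) \<subseteq> oval ` cball 0 1"
    by (intro closure_minimal image_mono) auto
  moreover have "P z0 \<in> closure (oval ` ball 0 1)"
  proof -
    have "P ` closure (ball 0 r) \<subseteq> closure (oval ` ball 0 1)"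
      using r0 r1 inside
      by (intro image_closure_subset contP) (auto intro: closure_subset[THEN subsetD])
    thus ?thesis using r0 by (auto simp: r_def)
  qed
  ultimately obtain \<zeta> where \<zeta>: "norm \<zeta> \<le> 1" "P z0 = oval \<zeta>" by auto
  with Pz0 have \<zeta>1: "norm \<zeta> = 1" by (cases "norm \<zeta> < 1") auto
  obtain h where h: "h holomorphic_on (oval ` ball 0 (3 / 2))"
    "\<And>z. norm z < 3 / 2 \<Longrightarrow> h (oval z) = z" and opn: "open (oval ` ball 0 (3 / 2))"
    using oval_inverse by metis
  define \<omega> where "\<omega> = h \<circ> P"
  have hz0: "h (P z0) = \<zeta>" using \<zeta> \<zeta>1 h(2)[of \<zeta>] by simp
  have in32: "P z0 \<in> oval ` ball 0 (3 / 2)" using \<zeta> \<zeta>1 by auto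
  have omega: "norm (\<omega> z) < 1" "oval (\<omega> z) = P z" if z: "norm z < r" for z
  proof -
    obtain u where u: "norm u < 1" "P z = oval u" using inside[OF z] by auto
    moreover have "h (oval u) = u" using u by (intro h(2)) auto
    ultimately show "norm (\<omega> z) < 1" "oval (\<omega> z) = P z" by (auto simp: \<omega>_def)
  qed
  have dP: "(P has_field_derivative deriv P z0) (at z0)"
    using r1 by (intro holomorphic_derivI[OF holo]) (auto simp: r_def)
  have dh: "(h has_field_derivative deriv h (P z0)) (at (P z0))"
    using in32 by (intro holomorphic_derivI[OF h(1) opn]) auto
  have d\<omega>: "(\<omega> has_field_derivative (deriv h (P z0) * deriv P z0)) (at z0)"
    unfolding \<omega>_def by (intro DERIV_chain dP dh)
  \<comment> \<open>Differentiating oval o h = id shows that \<open>deriv h (P z0)\<close> is the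
    reciprocal of the derivative of \<open>oval\<close> at \<open>\<zeta>\<close>.\<close>
  have "((\<lambda>z. oval (h z)) has_field_derivative ((1 - (h (P z0))\<^sup>2 / 3) * deriv h (P z0))) (at (P z0))"
    using DERIV_chain2[OF has_field_derivative_oval dh] .
  moreover have "((\<lambda>z. oval (h z)) has_field_derivative 1) (at (P z0))"
  proof (rule has_field_derivative_transform_within_open[OF DERIV_ident opn in32])
    fix x assume "x \<in> oval ` ball 0 (3 / 2)"
    thus "x = oval (h x)" using h(2) by auto
  qed
  ultimately have inv: "(1 - \<zeta>\<^sup>2 / 3) * deriv h (P z0) = 1"
    using DERIV_unique hz0 by fastforce
  obtain L where L: "1 \<le> L" "z0 * (deriv h (P z0) * deriv P z0) = of_real L * \<omega> z0"
  proof (rule Jack[OF _ r0 _ omega(1) r_def[symmetric] d\<omega>])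
    show "\<omega> holomorphic_on ball 0 r"
      unfolding \<omega>_def
    proof (rule holomorphic_on_compose_gen[OF holomorphic_on_subset[OF holo] h(1)])
      show "P ` ball 0 r \<subseteq> oval ` ball 0 (3 / 2)"
      proof clarify
        fix z :: complex assume "z \<in> ball 0 r"
        hence "P z \<in> oval ` ball 0 1" by (intro inside) simp
        thus "P z \<in> oval ` ball 0 (3 / 2)" by force
      qed
    qed (use r1 in auto)
    have "oval 0 = 0" by (simp add: oval_def)
    thus "\<omega> 0 = 0" using h(2)[of 0] by (simp add: \<omega>_def P0)
    show "norm (\<omega> z0) = 1" by (simp add: \<omega>_def hz0 \<zeta>1)
  qed (use that in auto)
  have "nephroid (w z0) = z0 * deriv P z0"
    using ode[of z0] r1 by (simp add: r_def)
  also have "\<dots> = (1 - \<zeta>\<^sup>2 / 3) * (z0 * (deriv h (P z0) * deriv P z0))"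
    using inv by (metis (no_types, opaque_lifting) mult.assoc mult.commute mult_1)
  also have "\<dots> = of_real L * nephroid \<zeta>"
    unfolding L by (simp add: \<omega>_def hz0 nephroid_def power2_eq_square power3_eq_cube algebra_simps)
  finally show False
    using nephroid_starlike[OF w \<zeta>1 L(1), of z0] r1 by (simp add: r_def)
qed

section \<open>A disc and a quartic region containing the oval\<close>

lemma norm_oval_less:
  assumes "norm z < 1"
  shows "norm (oval z) < 10 / 9"
proof -
  have "norm (oval z) \<le> norm z + norm z ^ 3 / 9"
    using norm_triangle_ineq4[of z "z ^ 3 / 9"] by (simp add: oval_def norm_power norm_divide)
  moreover have "norm z ^ 3 \<le> 1" using assms by (simp add: power_le_one)
  ultimately show ?thesis using assms by linarith
qed

text \<open>This is what remains of \<open>oval_quartic_boundary\<close> after division by (1 -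
  c)^2. The factor \<open>(1 + c) * (5 - 2 * c\<^sup>2)\<^sup>2\<close> is replaced by a linear
  majorant, whose constant 29.2 is chosen because 0.3 * 29.2^2 is just below 256.\<close>

lemma quartic_ineq:
  fixes c :: real
  assumes "0 \<le> c" "c \<le> 1"
  shows "3 / 10 * ((1 + c) * (5 - 2 * c\<^sup>2)\<^sup>2)\<^sup>2 \<le> 128 * (2 + c)"
proof -
  define g where "g = (1 + c) * (5 - 2 * c\<^sup>2)\<^sup>2"
  have c4: "c ^ 4 \<le> c ^ 3" "c ^ 5 \<le> c ^ 3"
    using assms by (auto intro: power_decreasing)
  have "0 \<le> (3 * c - 1)\<^sup>2 * (3 * c + 2)" using assms by simp
  \<comment> \<open>This bounds 27 c^3 below by its tangent at c = 1/3. What is then left to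
    estimate is 20 c^2 - 14.5 c, whose minimiser is 29/80.\<close>
  hence "9 * c - 2 \<le> 27 * c ^ 3" by (simp add: power2_eq_square power3_eq_cube algebra_simps)
  moreover have "0 \<le> (c - 29 / 80)\<^sup>2" by simp
  ultimately have "0 \<le> 4.2 - 18.5 * c + 20 * c\<^sup>2 + 12 * c ^ 3"
    by (simp add: power2_eq_square algebra_simps)
  moreover have "g = 25 + 25 * c - 20 * c\<^sup>2 - 20 * c ^ 3 + 4 * c ^ 4 + 4 * c ^ 5"
    unfolding g_def by (simp add: power2_eq_square power3_eq_cube power4_eq_xxxx eval_nat_numeral algebra_simps)
  ultimately have "g \<le> 29.2 + 6.5 * c" using c4 by linarith
  moreover have "0 \<le> g" using assms by (simp add: g_def)
  ultimately have "g\<^sup>2 \<le> (29.2 + 6.5 * c)\<^sup>2" by (intro power_mono) auto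
  also have "\<dots> = 852.64 + 379.6 * c + 42.25 * c\<^sup>2" by (simp add: power2_eq_square algebra_simps)
  also have "c\<^sup>2 \<le> c" using assms by (simp add: power2_eq_square mult_left_le_one_le)
  finally show ?thesis using assms unfolding g_def[symmetric] by simp
qed

text \<open>With c = abs (Re z), both 8/9 - abs x = 4/9 (1 - c)^2 (2 + c) and y^4 contain the factor
  (1 - c)^2, the latter because (Im z)^2 = 1 - c^2. This is the fourth-order contact of the oval
  with its vertical tangent.\<close>

lemma oval_quartic_boundary:
  assumes "norm z = 1"
  shows "(8 / 9) ^ 3 * \<bar>Re (oval z)\<bar> + 3 / 10 * Im (oval z) ^ 4 \<le> (8 / 9) ^ 4"
proof -
  define c where "c = \<bar>Re z\<bar>"
  have s2: "(Im z)\<^sup>2 = 1 - c\<^sup>2"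
    using assms cmod_power2[of z] by (simp add: c_def)
  have c: "0 \<le> c" "c \<le> 1" using abs_Re_le_cmod[of z] assms by (auto simp: c_def)
  have "Re (oval z) = Re z * (8 / 9 * (3 - c\<^sup>2) / 2)"
    using s2 by (simp add: oval_def c_def power3_eq_cube power2_eq_square algebra_simps) algebra
  moreover have "0 \<le> 8 / 9 * (3 - c\<^sup>2) / 2" using c abs_square_le_1[of c] by simp
  ultimately have "\<bar>Re (oval z)\<bar> = c * (8 / 9 * (3 - c\<^sup>2) / 2)"
    by (simp only: abs_mult abs_of_nonneg c_def)
  hence re: "\<bar>Re (oval z)\<bar> = 4 / 9 * (3 * c - c ^ 3)"
    by (simp add: power3_eq_cube power2_eq_square algebra_simps)
  have "Im (oval z) = Im z * (2 / 9 * (5 - 2 * c\<^sup>2))"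
    using s2 by (simp add: oval_def c_def power3_eq_cube power2_eq_square algebra_simps) algebra
  hence "Im (oval z) ^ 4 = ((Im z)\<^sup>2)\<^sup>2 * (2 / 9 * (5 - 2 * c\<^sup>2)) ^ 4"
    by (simp only: power_mult_distrib flip: power_mult) simp
  also have "\<dots> = (8 / 9) ^ 4 / 256 * ((1 - c) * ((1 + c) * (5 - 2 * c\<^sup>2)\<^sup>2))\<^sup>2"
  proof -
    have "(1 - c\<^sup>2)\<^sup>2 * (2 / 9 * A) ^ 4 = (8 / 9) ^ 4 / 256 * ((1 - c) * ((1 + c) * A\<^sup>2))\<^sup>2" for A
      by (simp add: power2_eq_square power4_eq_xxxx field_simps)
    thus ?thesis unfolding s2 .
  qed
  finally have im: "Im (oval z) ^ 4 = (8 / 9) ^ 4 / 256 * ((1 - c)\<^sup>2 * ((1 + c) * (5 - 2 * c\<^sup>2)\<^sup>2)\<^sup>2)"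
    by (simp only: power_mult_distrib)
  have "(1 - c)\<^sup>2 * (3 / 10 * ((1 + c) * (5 - 2 * c\<^sup>2)\<^sup>2)\<^sup>2) \<le> (1 - c)\<^sup>2 * (128 * (2 + c))"
    using quartic_ineq[OF c] by (intro mult_left_mono) auto
  also have "\<dots> = 128 * (2 - 3 * c + c ^ 3)" by (simp add: power2_eq_square power3_eq_cube algebra_simps)
  finally show ?thesis unfolding re im by (simp add: field_simps)
qed

text \<open>The region \<open>A x + B y\<^sup>4 \<le> D\<close> is the intersection of the half-planes below the tangents
  of its boundary, and on each of them the maximum principle applies.\<close>

lemma oval_quartic:
  assumes z: "norm z < 1"
  shows "(8 / 9) ^ 3 * \<bar>Re (oval z)\<bar> + 3 / 10 * Im (oval z) ^ 4 < (8 / 9) ^ 4"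
proof -
  have right: "(8 / 9) ^ 3 * Re (oval z) + 3 / 10 * Im (oval z) ^ 4 \<le> (8 / 9) ^ 4" if "norm z < 1" for z
  proof -
    define y0 where "y0 = Im (oval z)"
    \<comment> \<open>Re G is the linear function that defines the tangent at height
      \<open>y0\<close>; the circle estimate uses that y^4 lies above its tangent at
      \<open>y0\<close>. Evaluating at \<open>z\<close> itself recovers the quartic term.\<close>
    define G where "G v = of_real ((8 / 9) ^ 3) * oval v - \<i> * of_real (3 / 10 * (4 * y0 ^ 3)) * oval v" for v
    have "Re (G z) \<le> (8 / 9) ^ 4 + 9 / 10 * y0 ^ 4"
    proof (rule maximum_real_frontier[of G "ball 0 1"])
      show "G holomorphic_on interior (ball 0 1)" "continuous_on (closure (ball 0 1)) G"
        unfolding G_def by (intro holomorphic_intros continuous_intros)+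
      fix v :: complex assume "v \<in> frontier (ball 0 1)"
      hence v: "norm v = 1" by simp
      define y where "y = Im (oval v)"
      have "0 \<le> (y - y0)\<^sup>2 * ((y + y0)\<^sup>2 + 2 * y0\<^sup>2)" by simp
      also have "\<dots> = y ^ 4 - 4 * y0 ^ 3 * y + 3 * y0 ^ 4"
        by (simp add: power2_eq_square power3_eq_cube power4_eq_xxxx algebra_simps)
      finally have "4 * y0 ^ 3 * y \<le> y ^ 4 + 3 * y0 ^ 4" by simp
      moreover have "(8 / 9) ^ 3 * Re (oval v) \<le> (8 / 9) ^ 3 * \<bar>Re (oval v)\<bar>" by simp
      moreover have "Re (G v) = (8 / 9) ^ 3 * Re (oval v) + 3 / 10 * (4 * y0 ^ 3 * y)"
        by (simp add: G_def y_def)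
      ultimately show "Re (G v) \<le> (8 / 9) ^ 4 + 9 / 10 * y0 ^ 4"
        using oval_quartic_boundary[OF v] unfolding y_def[symmetric] by linarith
    qed (use that in auto)
    thus ?thesis by (simp add: G_def y0_def power3_eq_cube power4_eq_xxxx)
  qed
  have strict: "(8 / 9) ^ 3 * Re (oval z) + 3 / 10 * Im (oval z) ^ 4 < (8 / 9) ^ 4" if "norm z < 1" for z
  proof -
    \<comment> \<open>Strictness comes from openness of the image: a slightly larger real part with
      the same imaginary part is attained as well.\<close>
    have "oval z \<in> oval ` ball 0 1" using that by auto
    then obtain e where e: "e > 0" "cball (oval z) e \<subseteq> oval ` ball 0 1"
      using open_contains_cball open_oval_image by metis
    have "oval z + of_real e \<in> cball (oval z) e" using e by (simp add: dist_norm)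
    then obtain v where "norm v < 1" "oval v = oval z + of_real e" using e by (metis (no_types, lifting) imageE mem_ball_0 subsetD)
    hence "(8 / 9) ^ 3 * (Re (oval z) + e) + 3 / 10 * Im (oval z) ^ 4 \<le> (8 / 9) ^ 4"
      using right[of v] by simp
    moreover have "0 < (8 / 9) ^ 3 * e" using e by simp
    ultimately show ?thesis by (simp only: distrib_left)
  qed
  have "oval (- z) = - oval z" by (simp add: oval_def)
  thus ?thesis using strict[of z] strict[of "-z"] z by (auto simp: abs_if)
qed

section \<open>Removable singularities of the logarithmic derivative\<close>

definition log_deriv :: "(complex \<Rightarrow> complex) \<Rightarrow> complex \<Rightarrow> complex" where
  "log_deriv f z = z * deriv f z / f z"

lemma class_A_holomorphic:
  assumes "f \<in> class_A"
  shows "f holomorphic_on unit_disc" "deriv f holomorphic_on unit_disc"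
    "deriv (deriv f) holomorphic_on unit_disc"
  using assms by (auto simp: class_A_def intro!: holomorphic_deriv)

text \<open>\<open>remove_sings\<close> depends only on punctured neighbourhoods; by this lemma all
  divisions there are genuine, even around zeros of \<open>f\<close> or
  \<open>deriv f\<close>.\<close>

lemma class_A_eventually_nonzero:
  assumes f: "f \<in> class_A" and z: "norm z < 1"
  shows "eventually (\<lambda>x. norm x < 1 \<and> x \<noteq> 0 \<and> f x \<noteq> 0 \<and> deriv f x \<noteq> 0) (at z)"
proof -
  have df: "deriv f 0 = 1" and f0: "f 0 = 0" using f by (auto simp: class_A_def)
  have "\<exists>b\<in>unit_disc. f b \<noteq> 0"
  proof (rule ccontr)
    assume "\<not> ?thesis"
    hence "deriv f 0 = deriv (\<lambda>_. 0) 0"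
      by (intro deriv_cong_ev) (auto simp: eventually_nhds intro!: exI[of _ "unit_disc"])
    thus False using df by simp
  qed
  then obtain b where "b \<in> unit_disc" "f b \<noteq> 0" by blast
  hence "\<forall>\<^sub>F x in at z. f x \<noteq> 0 \<and> x \<in> unit_disc"
    using non_zero_neighbour_alt[OF class_A_holomorphic(1)[OF f], of z b] z by auto
  moreover have "\<forall>\<^sub>F x in at z. deriv f x \<noteq> 0 \<and> x \<in> unit_disc"
    using non_zero_neighbour_alt[OF class_A_holomorphic(2)[OF f], of z 0] z df by auto
  ultimately show ?thesis
    by eventually_elim (use f0 in auto)
qed

text \<open>With p = z f'/f, logarithmic differentiation gives z p'/p = 1 - p + z f''/f'. The first
  form concerns the function after \<open>remove_sings\<close>, the second the raw formula, which is
  needed when taking limits.\<close>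

lemma beta_expr_eq:
  assumes f: "f \<in> class_A" and x: "norm x < 1" and nz: "f x \<noteq> 0" "deriv f x \<noteq> 0"
  shows "beta_expr \<beta> f x = 1 + of_real \<beta> * (x * deriv (log_deriv f) x)"
    and "1 + of_real \<beta> * (x * deriv f x / f x) * (1 - x * deriv f x / f x + x * deriv (deriv f) x / deriv f x) =
      1 + of_real \<beta> * (x * deriv (log_deriv f) x)"
proof -
  note holo = class_A_holomorphic[OF f]
  have d: "(f has_field_derivative deriv f x) (at x)"
    "(deriv f has_field_derivative deriv (deriv f) x) (at x)"
    "(deriv (deriv f) has_field_derivative deriv (deriv (deriv f)) x) (at x)"
    using x by (auto intro!: holomorphic_derivI[where S = unit_disc] holo)
  have "(log_deriv f has_field_derivative
      ((deriv f x + x * deriv (deriv f) x) * f x - x * deriv f x * deriv f x) / (f x * f x)) (at x)"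
    unfolding log_deriv_def using nz d(1)
    by (auto intro!: derivative_eq_intros d(2) simp: divide_simps)
  hence d_eq: "deriv (log_deriv f) x =
      ((deriv f x + x * deriv (deriv f) x) * f x - x * deriv f x * deriv f x) / (f x * f x)"
    by (rule DERIV_imp_deriv)
  thus eq: "1 + of_real \<beta> * (x * deriv f x / f x) * (1 - x * deriv f x / f x + x * deriv (deriv f) x / deriv f x) =
      1 + of_real \<beta> * (x * deriv (log_deriv f) x)"
    unfolding d_eq using nz by (simp add: divide_simps) (simp add: algebra_simps)
  have "beta_expr \<beta> f x =
      1 + of_real \<beta> * (x * deriv f x / f x) * (1 - x * deriv f x / f x + x * deriv (deriv f) x / deriv f x)"
    unfolding beta_expr_def
    by (intro remove_sings_eqI tendsto_intros d[THEN DERIV_isCont, THEN isContD] nz)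
  thus "beta_expr \<beta> f x = 1 + of_real \<beta> * (x * deriv (log_deriv f) x)"
    using eq by simp
qed

text \<open>At a zero of \<open>f\<close> other than 0 the logarithmic derivative has a pole, hence so does its derivative.\<close>

lemma beta_expr_holomorphic_imp_nonzero:
  assumes f: "f \<in> class_A" and \<beta>: "\<beta> \<noteq> 0" and holo: "beta_expr \<beta> f holomorphic_on unit_disc"
    and a: "norm a < 1" "a \<noteq> 0"
  shows "f a \<noteq> 0"
proof
  assume fa: "f a = 0"
  note hf = class_A_holomorphic[OF f]
  have an: "f analytic_on {a}" "deriv f analytic_on {a}"
    using a hf(1,2) by (auto simp: analytic_at intro!: exI[of _ unit_disc])
  have ev: "\<forall>\<^sub>F x in at a. norm x < 1 \<and> x \<noteq> 0 \<and> f x \<noteq> 0 \<and> deriv f x \<noteq> 0"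
    by (rule class_A_eventually_nonzero[OF f a(1)])
  have "is_pole (\<lambda>z. deriv f z / f z) a"
  proof (rule deriv_divide_is_pole)
    show "isolated_singularity_at f a" "not_essential f a"
      using an by (auto intro: isolated_singularity_at_analytic not_essential_analytic)
    show "\<exists>\<^sub>F w in at a. deriv f w * f w \<noteq> 0"
      by (intro eventually_frequently) (use ev in \<open>auto elim: eventually_mono\<close>)
    have "\<exists>\<^sub>F x in at a. f x \<noteq> 0"
      by (intro eventually_frequently) (use ev in \<open>auto elim: eventually_mono\<close>)
    thus "zorder f a \<noteq> 0"
      using zorder_eq_0_iff[OF an(1)] fa by auto
  qed
  \<comment> \<open>Here \<open>a \<noteq> 0\<close> is essential: at the origin the factor z
    cancels the simple pole.\<close>
  hence "is_pole (\<lambda>z. z * (deriv f z / f z)) a"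
    using a by (subst is_pole_mult_analytic_nonzero1_iff) auto
  hence "is_pole (log_deriv f) a"
    by (simp add: log_deriv_def[abs_def])
  moreover have "log_deriv f meromorphic_on {a}"
    unfolding log_deriv_def[abs_def]
    by (intro meromorphic_intros analytic_on_imp_meromorphic_on an)
  ultimately have "is_pole (deriv (log_deriv f)) a"
    by (simp add: is_pole_deriv_iff)
  hence "is_pole (\<lambda>z. of_real \<beta> * z * deriv (log_deriv f) z) a"
    using a \<beta> by (subst is_pole_mult_analytic_nonzero1_iff) (auto intro!: analytic_intros)
  hence "filterlim (\<lambda>z. of_real \<beta> * z * deriv (log_deriv f) z) at_infinity (at a)"
    by (simp add: is_pole_def)
  moreover have "((\<lambda>z. beta_expr \<beta> f z - 1) \<longlongrightarrow> beta_expr \<beta> f a - 1) (at a)"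
    using a by (intro tendsto_intros isContD holomorphic_on_imp_continuous_on[OF holo, THEN continuous_on_interior]) auto
  hence "((\<lambda>z. of_real \<beta> * z * deriv (log_deriv f) z) \<longlongrightarrow> beta_expr \<beta> f a - 1) (at a)"
    by (rule Lim_transform_eventually)
      (use ev in eventually_elim, simp add: beta_expr_eq(1)[OF f] mult.assoc)
  ultimately show False
    using not_tendsto_and_filterlim_at_infinity[of "at a"] by auto
qed

text \<open>Writing f z = z g z with g free of zeros, p = f'/g is holomorphic. Zeros of
  \<open>deriv f\<close> do no harm: the raw formula breaks down there, but nearby it agrees with 1
  + \<beta> z p', so the singularity is removed with that value.\<close>

lemma log_deriv_extension:
  assumes f: "f \<in> class_A" and nz: "\<And>z. norm z < 1 \<Longrightarrow> z \<noteq> 0 \<Longrightarrow> f z \<noteq> 0"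
  obtains p where "p holomorphic_on unit_disc" "p 0 = 1"
    "\<And>z. norm z < 1 \<Longrightarrow> z \<noteq> 0 \<Longrightarrow> p z = z * deriv f z / f z"
    "\<And>z. norm z < 1 \<Longrightarrow> remove_sings (\<lambda>z. z * deriv f z / f z) z = p z"
    "\<And>\<beta> z. norm z < 1 \<Longrightarrow> beta_expr \<beta> f z = 1 + of_real \<beta> * (z * deriv p z)"
proof -
  note holo = class_A_holomorphic[OF f]
  have df: "deriv f 0 = 1" and f0: "f 0 = 0" using f by (auto simp: class_A_def)
  obtain g where g: "g holomorphic_on unit_disc" "\<And>z. norm z < 1 \<Longrightarrow> f z = z * g z" "deriv f 0 = g 0"
    using Schwarz3[OF holo(1) f0] by metis
  have gnz: "g z \<noteq> 0" if "norm z < 1" for z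
    using nz[of z] g(2)[of z] g(3) df that by (cases "z = 0") auto
  define p where "p z = deriv f z / g z" for z
  have p: "p holomorphic_on unit_disc"
    unfolding p_def using gnz by (intro holomorphic_intros holo g) auto
  have p_eq: "p z = log_deriv f z" if "norm z < 1" "z \<noteq> 0" for z
    using that g(2)[of z] by (simp add: p_def log_deriv_def)
  have cont: "q \<midarrow>z\<rightarrow> q z" if "q holomorphic_on unit_disc" "norm z < 1" for q z
    using that by (intro isContD holomorphic_on_imp_continuous_on[THEN continuous_on_interior]) auto
  have rem: "remove_sings (\<lambda>z. z * deriv f z / f z) z = p z" if "norm z < 1" for z
  proof (intro remove_sings_eqI Lim_transform_eventually[OF cont[OF p that]])
    show "\<forall>\<^sub>F x in at z. p x = x * deriv f x / f x"
      using class_A_eventually_nonzero[OF f that]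
      by eventually_elim (simp add: p_eq log_deriv_def)
  qed
  have beta: "beta_expr \<beta> f z = 1 + of_real \<beta> * (z * deriv p z)" if z: "norm z < 1" for \<beta> z
    unfolding beta_expr_def
  proof (intro remove_sings_eqI)
    have "(\<lambda>z. 1 + of_real \<beta> * (z * deriv p z)) holomorphic_on unit_disc"
      using p by (intro holomorphic_intros holomorphic_deriv) auto
    from cont[OF this z]
    show "(\<lambda>z. 1 + of_real \<beta> * (z * deriv f z / f z) *
       (1 - z * deriv f z / f z + z * deriv (deriv f) z / deriv f z)) \<midarrow>z\<rightarrow> 1 + of_real \<beta> * (z * deriv p z)"
    proof (rule Lim_transform_eventually)
      show "\<forall>\<^sub>F x in at z. 1 + of_real \<beta> * (x * deriv p x) = 1 + of_real \<beta> * (x * deriv f x / f x) *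
       (1 - x * deriv f x / f x + x * deriv (deriv f) x / deriv f x)"
        using class_A_eventually_nonzero[OF f z]
      proof eventually_elim
        case (elim x)
        have "deriv p x = deriv (log_deriv f) x"
        proof (intro deriv_cong_ev refl)
          have "\<forall>\<^sub>F y in nhds x. y \<in> unit_disc - {0}"
            using elim by (intro eventually_nhds_in_open) auto
          thus "\<forall>\<^sub>F y in nhds x. p y = log_deriv f y"
            by eventually_elim (simp add: p_eq)
        qed
        thus ?case using beta_expr_eq(2)[OF f, of x \<beta>] elim by simp
      qed
    qed
  qed
  have "p 0 = 1" using g(3) df by (simp add: p_def)
  thus ?thesis using p p_eq rem beta that unfolding log_deriv_def by blast
qed

section \<open>Majorants of the oval\<close>

text \<open>Here \<open>\<delta> = 1 - \<phi>(-1)\<close>, and \<open>boundary\<close> says that \<open>\<phi> \<zeta> - 1\<close> violates one of the bounds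
  \<open>norm_oval_less\<close> and \<open>oval_quartic\<close>, rescaled so that \<open>8/9\<close> becomes \<open>\<delta>\<close>.\<close>

locale oval_majorant =
  fixes \<phi> :: "complex \<Rightarrow> complex" and \<delta> :: real
  assumes \<delta>_pos: "0 < \<delta>"
    and holo: "\<phi> holomorphic_on unit_disc"
    and cont: "continuous_on (cball 0 1) \<phi>"
    and inj: "inj_on \<phi> unit_disc"
    and at_0: "\<phi> 0 = 1"
    and cnj: "\<And>z. norm z < 1 \<Longrightarrow> \<phi> (cnj z) = cnj (\<phi> z)"
    and real_axis: "\<And>t. -1 < t \<Longrightarrow> t < 1 \<Longrightarrow> 1 - \<delta> \<le> Re (\<phi> (of_real t))"
    and boundary: "\<And>\<zeta>. norm \<zeta> = 1 \<Longrightarrow>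
      5 / 4 * \<delta> \<le> norm (\<phi> \<zeta> - 1) \<or>
      \<delta> ^ 4 \<le> \<delta> ^ 3 * \<bar>Re (\<phi> \<zeta> - 1)\<bar> + 3 / 10 * Im (\<phi> \<zeta> - 1) ^ 4"
begin

lemma \<beta>_bound:
  assumes "8 / (9 * \<delta>) \<le> \<beta>"
  shows "0 < \<beta>" "1 / \<beta> \<le> 9 * \<delta> / 8"
proof -
  show \<beta>: "0 < \<beta>" using assms \<delta>_pos by (smt (verit) divide_pos_pos)
  show "1 / \<beta> \<le> 9 * \<delta> / 8" using assms \<beta> \<delta>_pos by (simp add: field_simps)
qed

text \<open>Both tests are monotone in the scale \<open>1 / \<beta>\<close>, so the worst case is
  the critical \<beta>, at which the scaled oval meets the rescaled bounds exactly.\<close>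

lemma boundary_not_oval:
  assumes \<beta>: "8 / (9 * \<delta>) \<le> \<beta>" and z: "norm z < 1" and \<zeta>: "norm \<zeta> = 1"
  shows "1 + oval z / of_real \<beta> \<noteq> \<phi> \<zeta>"
proof
  assume eq: "1 + oval z / of_real \<beta> = \<phi> \<zeta>"
  note b = \<beta>_bound[OF \<beta>]
  define s where "s = 1 / \<beta>"
  have s: "0 < s" "s \<le> 9 * \<delta> / 8" using b by (auto simp: s_def)
  have d: "\<phi> \<zeta> - 1 = of_real s * oval z" by (simp add: s_def flip: eq)
  from boundary[OF \<zeta>] show False
  proof
    assume "5 / 4 * \<delta> \<le> norm (\<phi> \<zeta> - 1)"
    also have "\<dots> = s * norm (oval z)" using s by (simp add: d norm_mult)
    also have "\<dots> < s * (10 / 9)" using norm_oval_less[OF z] s by simp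
    finally show False using s by simp
  next
    define X where "X = \<bar>Re (oval z)\<bar>"
    define Y where "Y = Im (oval z) ^ 4"
    \<comment> \<open>The value of \<open>s\<close> at the critical \<beta>. Scaling by it sends 8/9
      to \<delta> and 10/9 to 5/4 \<delta>.\<close>
    define \<sigma> where "\<sigma> = 9 * \<delta> / 8"
    have nn: "0 \<le> X" "0 \<le> Y" by (auto simp: X_def Y_def)
    assume "\<delta> ^ 4 \<le> \<delta> ^ 3 * \<bar>Re (\<phi> \<zeta> - 1)\<bar> + 3 / 10 * Im (\<phi> \<zeta> - 1) ^ 4"
    also have "\<dots> = \<delta> ^ 3 * (s * X) + 3 / 10 * (s ^ 4 * Y)"
      using s by (simp add: d abs_mult X_def Y_def power_mult_distrib)
    also have "\<dots> \<le> \<delta> ^ 3 * (\<sigma> * X) + 3 / 10 * (\<sigma> ^ 4 * Y)"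
      using s nn \<delta>_pos by (intro add_mono mult_left_mono mult_right_mono power_mono) (auto simp: \<sigma>_def)
    also have "\<dots> = \<sigma> ^ 4 * ((8 / 9) ^ 3 * X + 3 / 10 * Y)"
      by (simp add: \<sigma>_def field_simps power3_eq_cube power4_eq_xxxx)
    also have "\<dots> < \<sigma> ^ 4 * (8 / 9) ^ 4"
      using oval_quartic[OF z] \<delta>_pos by (intro mult_strict_left_mono) (auto simp: X_def Y_def \<sigma>_def)
    also have "\<dots> = \<delta> ^ 4" by (simp add: \<sigma>_def power_mult_distrib power_divide)
    finally show False by simp
  qed
qed

text \<open>The set q(D) is connected and contains \<phi>(0) = 1, so it could leave \<phi>(D) only
  through the frontier, whose points are values of \<phi> on the unit circle; these are excluded by
  \<open>boundary_not_oval\<close>.\<close>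

lemma oval_in_image:
  assumes \<beta>: "8 / (9 * \<delta>) \<le> \<beta>" and z: "norm z < 1"
  shows "1 + oval z / of_real \<beta> \<in> \<phi> ` unit_disc"
proof (rule ccontr)
  assume not_in: "\<not> ?thesis"
  define Q where "Q = (\<lambda>z. 1 + oval z / of_real \<beta>) ` unit_disc"
  have "connected Q"
    unfolding Q_def using \<beta>_bound[OF \<beta>]
    by (intro connected_continuous_image continuous_intros) auto
  moreover have "\<phi> 0 \<in> Q"
    unfolding Q_def by (rule image_eqI[of _ _ 0]) (auto simp: at_0 oval_def)
  hence "Q \<inter> \<phi> ` unit_disc \<noteq> {}" by auto
  moreover have "1 + oval z / of_real \<beta> \<in> Q"
    using z by (auto simp: Q_def)
  hence "Q - \<phi> ` unit_disc \<noteq> {}" using not_in by blast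
  ultimately obtain x where x: "x \<in> Q" "x \<in> frontier (\<phi> ` unit_disc)"
    using connected_Int_frontier by blast
  have "open (\<phi> ` unit_disc)"
    by (intro open_mapping_thm3 holo inj open_ball)
  hence "x \<notin> \<phi> ` unit_disc" "x \<in> closure (\<phi> ` unit_disc)"
    using x by (auto simp: frontier_def interior_open)
  moreover have "closure (\<phi> ` unit_disc) \<subseteq> \<phi> ` cball 0 1"
    by (intro closure_minimal image_mono compact_imp_closed compact_continuous_image cont compact_cball) auto
  ultimately obtain \<zeta> where \<zeta>: "\<zeta> \<in> cball 0 1" "x = \<phi> \<zeta>" "\<zeta> \<notin> unit_disc" by blast
  obtain v where v: "v \<in> unit_disc" "x = 1 + oval v / of_real \<beta>"
    using x unfolding Q_def by blast
  have "norm \<zeta> = 1" "norm v < 1" using \<zeta> v by simp_all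
  thus False using boundary_not_oval[OF \<beta>] \<zeta>(2) v(2) by metis
qed

theorem starlike:
  assumes f: "f \<in> class_A" and sub: "beta_expr \<beta> f \<prec>\<^sub>D phi_Ne" and \<beta>: "8 / (9 * \<delta>) \<le> \<beta>"
  shows "f \<in> starlike_class \<phi>"
proof -
  have \<beta>0: "\<beta> > 0" by (rule \<beta>_bound[OF \<beta>])
  have bh: "beta_expr \<beta> f holomorphic_on unit_disc"
    using sub by (simp add: subordinate_def)
  obtain w where "\<forall>z\<in>unit_disc. norm (w z) < 1 \<and> beta_expr \<beta> f z = phi_Ne (w z)"
    using sub unfolding subordinate_def by blast
  hence w: "norm (w z) < 1" "beta_expr \<beta> f z = phi_Ne (w z)" if "norm z < 1" for z
    using that by auto
  have nz: "f z \<noteq> 0" if "norm z < 1" "z \<noteq> 0" for z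
    using beta_expr_holomorphic_imp_nonzero[OF f _ bh] \<beta>0 that by simp
  obtain p where p: "p holomorphic_on unit_disc" "p 0 = 1"
    "\<And>z. norm z < 1 \<Longrightarrow> remove_sings (\<lambda>z. z * deriv f z / f z) z = p z"
    "\<And>\<beta> z. norm z < 1 \<Longrightarrow> beta_expr \<beta> f z = 1 + of_real \<beta> * (z * deriv p z)"
    by (rule log_deriv_extension[OF f nz]) blast+
  define P where "P z = of_real \<beta> * (p z - 1)" for z
  have "P ` unit_disc \<subseteq> oval ` unit_disc"
  proof (rule image_subset_oval[of P w])
    show "P holomorphic_on unit_disc" unfolding P_def by (intro holomorphic_intros p)
    show "P 0 = 0" by (simp add: P_def p)
    fix z :: complex assume z: "norm z < 1"
    have "(p has_field_derivative deriv p z) (at z)"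
      using z by (intro holomorphic_derivI[OF p(1)]) auto
    hence "(P has_field_derivative of_real \<beta> * deriv p z) (at z)"
      unfolding P_def by (auto intro!: derivative_eq_intros)
    hence "deriv P z = of_real \<beta> * deriv p z" by (rule DERIV_imp_deriv)
    thus "z * deriv P z = nephroid (w z)"
      using p(4)[OF z, of \<beta>] w(2)[OF z] by (simp add: phi_Ne_def nephroid_def)
  qed (fact w(1))
  hence "P z \<in> oval ` unit_disc" if "norm z < 1" for z using that by auto
  hence img: "p z \<in> \<phi> ` unit_disc" if z: "norm z < 1" for z
  proof -
    obtain v where v: "norm v < 1" "P z = oval v"
      using z \<open>\<And>z. norm z < 1 \<Longrightarrow> P z \<in> oval ` unit_disc\<close> by fastforce
    hence "p z = 1 + oval v / of_real \<beta>" using \<beta>0 by (simp add: P_def flip: v(2))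
    thus ?thesis using oval_in_image[OF \<beta> v(1)] by simp
  qed
  \<comment> \<open>Univalence of \<phi> turns containment of the values of p into subordination:
    \<phi>^(-1) o p is the required Schwarz function.\<close>
  obtain h where h: "h holomorphic_on (\<phi> ` unit_disc)" "\<And>z. z \<in> unit_disc \<Longrightarrow> h (\<phi> z) = z"
    using holomorphic_has_inverse[OF holo open_ball inj] by metis
  have "remove_sings (\<lambda>z. z * deriv f z / f z) \<prec>\<^sub>D \<phi>"
    unfolding subordinate_def
  proof (intro conjI exI[of _ "h \<circ> p"] ballI holo)
    show "remove_sings (\<lambda>z. z * deriv f z / f z) holomorphic_on unit_disc"
      using p(1) by (rule holomorphic_transform) (simp add: p(3))
    show "h \<circ> p holomorphic_on unit_disc"
      using img by (intro holomorphic_on_compose_gen[OF p(1) h(1)]) auto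
    show "(h \<circ> p) 0 = 0" using h(2)[of 0] by (simp add: p(2) at_0)
    fix z :: complex assume "z \<in> unit_disc"
    hence z: "norm z < 1" by simp
    then obtain v where v: "v \<in> unit_disc" "p z = \<phi> v" using img by blast
    show "norm ((h \<circ> p) z) < 1" using v h(2)[OF v(1)] by simp
    show "remove_sings (\<lambda>z. z * deriv f z / f z) z = \<phi> ((h \<circ> p) z)"
      using v h(2)[OF v(1)] by (simp add: p(3)[OF z])
  qed
  thus ?thesis using f by (simp add: starlike_class_def)
qed

text \<open>By symmetry \<open>cnj z\<close> has the same image as \<open>z\<close>, so injectivity
  makes \<open>z\<close> real and \<open>real_axis\<close> applies.\<close>

lemma real_value_bound:
  assumes "norm z < 1" "\<phi> z = of_real x"
  shows "1 - \<delta> \<le> x"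
proof -
  have "\<phi> (cnj z) = \<phi> z" using assms by (simp add: cnj)
  hence "cnj z = z" using inj assms by (auto simp: inj_on_def)
  hence z: "z = of_real (Re z)" by (simp add: complex_eq_iff)
  have "\<bar>Re z\<bar> < 1" using abs_Re_le_cmod[of z] assms by linarith
  thus ?thesis using real_axis[of "Re z"] assms z by (metis Re_complex_of_real abs_less_iff minus_less_iff)
qed

theorem sharp:
  assumes b: "b < 8 / (9 * \<delta>)"
  shows "\<exists>\<beta>\<ge>b. \<exists>f\<in>class_A. beta_expr \<beta> f \<prec>\<^sub>D phi_Ne \<and> f \<notin> starlike_class \<phi>"
proof -
  \<comment> \<open>Since \<open>b\<close> may be zero or negative, it is raised to half the
    critical value, which keeps \<beta> positive and below the threshold.\<close>
  define \<beta> where "\<beta> = max b (4 / (9 * \<delta>))"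
  have \<beta>0: "0 < \<beta>" using \<delta>_pos by (simp add: \<beta>_def less_max_iff_disj)
  have "\<beta> < 8 / (9 * \<delta>)" using \<delta>_pos b by (simp add: \<beta>_def field_simps)
  hence \<beta>1: "\<beta> * \<delta> < 8 / 9" using \<delta>_pos by (simp add: field_simps)
  \<comment> \<open>The exponent is the primitive of (q(z) - 1)/z = (1 - z^2/9)/\<beta> that
    vanishes at 0, so z f'/f = q.\<close>
  define f where "f z = z * exp ((z - z ^ 3 / 27) / of_real \<beta>)" for z :: complex
  define q where "q z = 1 + oval z / of_real \<beta>" for z
  have df: "(f has_field_derivative exp ((z - z ^ 3 / 27) / of_real \<beta>) * q z) (at z)" for z
    unfolding f_def q_def oval_def using \<beta>0
    by (auto intro!: derivative_eq_intros simp: field_simps power2_eq_square power3_eq_cube)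
  have df': "deriv f z = exp ((z - z ^ 3 / 27) / of_real \<beta>) * q z" for z
    using df by (rule DERIV_imp_deriv)
  have f: "f \<in> class_A"
  proof -
    have "f holomorphic_on unit_disc"
      unfolding f_def using \<beta>0 by (intro holomorphic_intros) auto
    thus ?thesis by (simp add: class_A_def df') (simp add: f_def q_def oval_def)
  qed
  have nz: "f z \<noteq> 0" if "norm z < 1" "z \<noteq> 0" for z using that by (simp add: f_def)
  obtain p where p: "p holomorphic_on unit_disc" "p 0 = 1"
    "\<And>z. norm z < 1 \<Longrightarrow> z \<noteq> 0 \<Longrightarrow> p z = z * deriv f z / f z"
    "\<And>z. norm z < 1 \<Longrightarrow> remove_sings (\<lambda>z. z * deriv f z / f z) z = p z"
    "\<And>\<beta> z. norm z < 1 \<Longrightarrow> beta_expr \<beta> f z = 1 + of_real \<beta> * (z * deriv p z)"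
    by (rule log_deriv_extension[OF f nz]) blast+
  have pq: "p z = q z" if "norm z < 1" for z
    using that p(2) p(3)[of z] by (cases "z = 0") (auto simp: df' f_def q_def oval_def)
  have bz: "beta_expr \<beta> f z = phi_Ne z" if z: "norm z < 1" for z
  proof -
    have "(q has_field_derivative (1 - z\<^sup>2 / 3) / of_real \<beta>) (at z)"
      unfolding q_def using \<beta>0 by (auto intro!: derivative_eq_intros has_field_derivative_oval)
    moreover have "deriv p z = deriv q z"
    proof (intro deriv_cong_ev refl)
      have "\<forall>\<^sub>F x in nhds z. x \<in> unit_disc" using z by (intro eventually_nhds_in_open) auto
      thus "\<forall>\<^sub>F x in nhds z. p x = q x" by eventually_elim (simp add: pq)
    qed
    ultimately have "deriv p z = (1 - z\<^sup>2 / 3) / of_real \<beta>" by (simp add: DERIV_imp_deriv)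
    hence "of_real \<beta> * (z * deriv p z) = z * (1 - z\<^sup>2 / 3)" using \<beta>0 by simp
    thus ?thesis unfolding p(5)[OF z]
      by (simp add: phi_Ne_def power2_eq_square power3_eq_cube algebra_simps)
  qed
  have Ne: "phi_Ne holomorphic_on unit_disc" unfolding phi_Ne_def by (intro holomorphic_intros) auto
  have "beta_expr \<beta> f \<prec>\<^sub>D phi_Ne"
    unfolding subordinate_def
  proof (intro conjI exI[of _ "\<lambda>z. z"] ballI Ne)
    show "beta_expr \<beta> f holomorphic_on unit_disc"
      using Ne by (rule holomorphic_transform) (simp add: bz)
  qed (auto simp: bz)
  moreover have "f \<notin> starlike_class \<phi>"
  proof
    assume "f \<in> starlike_class \<phi>"
    then obtain w where "\<forall>z\<in>unit_disc. norm (w z) < 1 \<and>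
        remove_sings (\<lambda>z. z * deriv f z / f z) z = \<phi> (w z)"
      unfolding starlike_class_def subordinate_def by blast
    hence w: "norm (w z) < 1 \<and> remove_sings (\<lambda>z. z * deriv f z / f z) z = \<phi> (w z)"
      if "norm z < 1" for z using that by auto
    \<comment> \<open>As t tends to 1, q(-t) tends to 1 - 8/(9 \<beta>) < 1 - \<delta>, so the
      forbidden real value is taken at an interior point and no boundary behaviour of \<phi>
      enters.\<close>
    have "((\<lambda>t::real. t - t ^ 3 / 9) \<longlongrightarrow> 1 - 1 ^ 3 / 9) (at_left 1)"
      by (intro tendsto_intros) auto
    hence "\<forall>\<^sub>F t in at_left 1. \<beta> * \<delta> < t - t ^ 3 / (9::real)"
      using \<beta>1 by (intro order_tendstoD) auto
    moreover have "\<forall>\<^sub>F t in at_left 1. t \<in> {0<..<(1::real)}"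
      by (intro eventually_at_leftI[of 0]) auto
    ultimately have "\<forall>\<^sub>F t in at_left 1. \<beta> * \<delta> < t - t ^ 3 / (9::real) \<and> t \<in> {0<..<(1::real)}"
      by (rule eventually_conj)
    then obtain t :: real where t: "\<beta> * \<delta> < t - t ^ 3 / 9" "0 < t" "t < 1"
      using eventually_happens[of _ "at_left (1::real)"] by (auto simp: trivial_limit_at_left_real)
    define z where "z = complex_of_real (- t)"
    have z: "norm z < 1" using t by (simp add: z_def)
    define A where "A = t - t ^ 3 / 9"
    have "oval z = - of_real A" by (simp add: oval_def z_def A_def)
    hence "q z = of_real (1 - A / \<beta>)" by (simp add: q_def)
    hence "\<phi> (w z) = of_real (1 - A / \<beta>)"
      using w[OF z] z by (simp only: p(4) pq)
    hence "1 - \<delta> \<le> 1 - A / \<beta>"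
      using real_value_bound w z by blast
    hence "A \<le> \<beta> * \<delta>" using \<beta>0 by (simp add: field_simps)
    thus False using t(1) by (simp add: A_def)
  qed
  moreover have "b \<le> \<beta>" by (simp add: \<beta>_def)
  ultimately show ?thesis using f by blast
qed

end

section \<open>Elementary inequalities\<close>

text \<open>The Taylor bounds that follow are obtained by integrating one another from 0.\<close>

lemma nonneg_if_deriv_nonneg:
  fixes f :: "real \<Rightarrow> real"
  assumes "\<And>x. 0 \<le> x \<Longrightarrow> (f has_real_derivative f' x) (at x)"
    and "\<And>x. 0 \<le> x \<Longrightarrow> 0 \<le> f' x" and "f 0 = 0" "0 \<le> x"
  shows "0 \<le> f x"
  using DERIV_nonneg_imp_nondecreasing[of 0 x f] assms by metis

lemma cos_ge_taylor2: "1 - x\<^sup>2 / 2 \<le> cos x" for x :: real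
proof -
  have *: "1 - x\<^sup>2 / 2 \<le> cos x" if "0 \<le> x" for x :: real
    using nonneg_if_deriv_nonneg[of "\<lambda>x. cos x - 1 + x\<^sup>2 / 2" "\<lambda>x. x - sin x" x] that
    by (force intro!: derivative_eq_intros simp: sin_x_le_x)
  show ?thesis using *[of "\<bar>x\<bar>"] by simp
qed

lemma sin_ge_taylor3: "0 \<le> x \<Longrightarrow> x - x ^ 3 / 6 \<le> sin x" for x :: real
  using nonneg_if_deriv_nonneg[of "\<lambda>x. sin x - x + x ^ 3 / 6" "\<lambda>x. cos x - 1 + x\<^sup>2 / 2" x] cos_ge_taylor2
  by (force intro!: derivative_eq_intros simp: algebra_simps)

lemma cos_le_taylor4: "cos x \<le> 1 - x\<^sup>2 / 2 + x ^ 4 / 24" for x :: real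
proof -
  have *: "cos x \<le> 1 - x\<^sup>2 / 2 + x ^ 4 / 24" if "0 \<le> x" for x :: real
    using nonneg_if_deriv_nonneg[of "\<lambda>x. 1 - x\<^sup>2 / 2 + x ^ 4 / 24 - cos x" "\<lambda>x. sin x - x + x ^ 3 / 6" x]
      that sin_ge_taylor3
    by (force intro!: derivative_eq_intros simp: algebra_simps)
  show ?thesis using *[of "\<bar>x\<bar>"] by simp
qed

lemma sin_le_taylor5: "0 \<le> x \<Longrightarrow> sin x \<le> x - x ^ 3 / 6 + x ^ 5 / 120" for x :: real
  using nonneg_if_deriv_nonneg[of "\<lambda>x. x - x ^ 3 / 6 + x ^ 5 / 120 - sin x"
      "\<lambda>x. 1 - x\<^sup>2 / 2 + x ^ 4 / 24 - cos x" x] cos_le_taylor4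
  by (force intro!: derivative_eq_intros simp: algebra_simps)

lemma sinh_ge_taylor1: "0 \<le> x \<Longrightarrow> 2 * x \<le> exp x - exp (- x)" for x :: real
  using nonneg_if_deriv_nonneg[of "\<lambda>x. exp x - exp (- x) - 2 * x" "\<lambda>x. exp x + exp (- x) - 2" x]
    cosh_real_ge_1
  by (force intro!: derivative_eq_intros simp: cosh_def)

lemma cosh_ge_taylor2: "2 + x\<^sup>2 \<le> exp x + exp (- x)" for x :: real
proof -
  have *: "2 + x\<^sup>2 \<le> exp x + exp (- x)" if "0 \<le> x" for x :: real
    using nonneg_if_deriv_nonneg[of "\<lambda>x. exp x + exp (- x) - 2 - x\<^sup>2" "\<lambda>x. exp x - exp (- x) - 2 * x" x]
      that sinh_ge_taylor1
    by (force intro!: derivative_eq_intros simp: algebra_simps)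
  show ?thesis using *[of x] *[of "-x"] by (cases "0 \<le> x") (auto simp: add.commute)
qed

lemma sinh_ge_taylor3: "0 \<le> x \<Longrightarrow> 2 * x + x ^ 3 / 3 \<le> exp x - exp (- x)" for x :: real
  using nonneg_if_deriv_nonneg[of "\<lambda>x. exp x - exp (- x) - 2 * x - x ^ 3 / 3"
      "\<lambda>x. exp x + exp (- x) - (2 + x\<^sup>2)" x] cosh_ge_taylor2
  by (force intro!: derivative_eq_intros simp: algebra_simps)

lemma exp_minus_ge_taylor3: "0 \<le> x \<Longrightarrow> 1 - x + x\<^sup>2 / 2 - x ^ 3 / 6 \<le> exp (- x)" for x :: real
proof -
  assume x: "0 \<le> x"
  have 1: "exp (- x) \<ge> 1 - x" for x :: real using exp_ge_add_one_self[of "-x"] by simp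
  have 2: "exp (- x) \<le> 1 - x + x\<^sup>2 / 2" if "0 \<le> x" for x :: real
    using nonneg_if_deriv_nonneg[of "\<lambda>x. 1 - x + x\<^sup>2 / 2 - exp (- x)" "\<lambda>x. exp (- x) - (1 - x)" x] that 1
    by (force intro!: derivative_eq_intros simp: algebra_simps)
  show ?thesis
    using nonneg_if_deriv_nonneg[of "\<lambda>x. exp (- x) - (1 - x + x\<^sup>2 / 2 - x ^ 3 / 6)"
        "\<lambda>x. 1 - x + x\<^sup>2 / 2 - exp (- x)" x] x 2
    by (force intro!: derivative_eq_intros simp: algebra_simps)
qed

section \<open>Boundary inequalities for the exponential and the sine\<close>

text \<open>For \<open>c \<ge> 0\<close> the disc test succeeds. For \<open>c < 0\<close> the
  quartic test is used in u = 1 + c: the excess over the strip and sin^4 s both have order u^2, so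
  only a polynomial comparison of their coefficients is left.\<close>

lemma exp_boundary_ineq:
  fixes c s :: real
  assumes cs: "c\<^sup>2 + s\<^sup>2 = 1"
  defines "\<delta> \<equiv> 1 - exp (- 1)"
  shows "(5 / 4 * \<delta>)\<^sup>2 \<le> (exp c - cos s)\<^sup>2 + (sin s)\<^sup>2 \<or>
    \<delta> ^ 4 \<le> \<delta> ^ 3 * \<bar>exp c * cos s - 1\<bar> + 3 / 10 * (exp c * sin s) ^ 4"
proof -
  define a where "a = \<bar>s\<bar>"
  define m where "m = s\<^sup>2"
  have m: "0 \<le> m" "m \<le> 1" "m = 1 - c\<^sup>2" using cs by (auto simp: m_def intro: sum_power2_ge_zero) (smt (verit) zero_le_power2)
  have a: "0 \<le> a" "a \<le> 1" "a\<^sup>2 = m"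
    using m by (auto simp: a_def m_def abs_square_le_1)
  have c: "-1 \<le> c" "c \<le> 1"
    using m abs_square_le_1[of c] by auto
  have sin_a: "a * (1 - m / 6) \<le> sin a"
    using sin_ge_taylor3[OF a(1)] a(3) by (simp add: power2_eq_square power3_eq_cube algebra_simps)
  have cos_a: "cos s \<le> 1 - m / 2 + m\<^sup>2 / 24"
    using cos_le_taylor4[of s] by (simp add: m_def)
  have sin2: "m * (1 - m / 6)\<^sup>2 \<le> (sin s)\<^sup>2"
  proof -
    have "(a * (1 - m / 6))\<^sup>2 \<le> (sin a)\<^sup>2"
      using a m(1,2) sin_a by (intro power_mono mult_nonneg_nonneg) auto
    moreover have "(sin a)\<^sup>2 = (sin s)\<^sup>2" by (simp add: a_def abs_if)
    ultimately show ?thesis using a by (simp add: power_mult_distrib)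
  qed
  have E: "25 / 68 < exp (- 1 :: real)" "exp (- 1 :: real) < 1"
    using e_less_272 by (auto simp: exp_minus field_simps)
  show ?thesis
  proof (cases "0 \<le> c")
    case True
    have m2: "m\<^sup>2 \<le> 1" using m by (simp add: power_le_one)
    have c2: "c\<^sup>2 \<le> c" using True c by (simp add: power2_eq_square mult_left_le_one_le)
    \<comment> \<open>From exp c >= 1 + c, m = 1 - c^2 and c^2 <= c; the constant is 1/2 -
      1/24.\<close>
    have "11 / 24 + c / 2 \<le> exp c - cos s"
      using exp_ge_add_one_self[of c] cos_a m(3) m2 c2 by linarith
    hence "(11 / 24 + c / 2)\<^sup>2 \<le> (exp c - cos s)\<^sup>2" using True by (intro power_mono) auto
    moreover have "m * (5 / 6)\<^sup>2 \<le> m * (1 - m / 6)\<^sup>2"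
      using m by (intro mult_left_mono power_mono) auto
    moreover have "(5 / 4 * \<delta>)\<^sup>2 \<le> (4 / 5)\<^sup>2"
      using E by (intro power_mono) (auto simp: \<delta>_def)
    moreover have "(11 / 24 + c / 2)\<^sup>2 = 121 / 576 + 11 / 24 * c + c\<^sup>2 / 4"
      by (simp add: power2_eq_square algebra_simps)
    ultimately have "(5 / 4 * \<delta>)\<^sup>2 \<le> (exp c - cos s)\<^sup>2 + (sin s)\<^sup>2"
      using sin2 m(3) c2 True c by (simp add: power2_eq_square[of "4/5"] power2_eq_square[of "5/6"])
    thus ?thesis ..
  next
    case False
    define u where "u = 1 + c"
    define v where "v = 1 - u"
    have u: "0 \<le> u" "u \<le> 1" "m = u * (2 - u)"
      using False c m by (auto simp: u_def power2_eq_square algebra_simps)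
    have v: "0 \<le> v" "v \<le> 1" using u by (auto simp: v_def)
    \<comment> \<open>All terms of order at most 1 in \<open>u\<close> cancel here, as \<open>1 - m/2 = 1 - u + u\<^sup>2/2\<close>.\<close>
    have cos_u: "exp u * cos s - 1 \<le> exp u * (u ^ 3 / 6 + m\<^sup>2 / 24)"
    proof -
      have "cos s \<le> 1 - u + u\<^sup>2 / 2 + m\<^sup>2 / 24"
      proof -
        have "m / 2 = u - u\<^sup>2 / 2" unfolding u(3) by (simp add: power2_eq_square field_simps)
        thus ?thesis using cos_a by linarith
      qed
      also have "\<dots> \<le> exp (- u) + u ^ 3 / 6 + m\<^sup>2 / 24"
        using exp_minus_ge_taylor3[OF u(1)] by simp
      finally have "exp u * cos s \<le> exp u * (exp (- u) + u ^ 3 / 6 + m\<^sup>2 / 24)"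
        by (intro mult_left_mono) auto
      thus ?thesis by (simp add: algebra_simps exp_minus)
    qed
    \<comment> \<open>Just above 1.72^3, a bound for (e - 1)^3.\<close>
    define K :: real where "K = 5089 / 1000"
    \<comment> \<open>Both sides are coefficients of exp u * u^2. The quadratic in u underestimates
      exp (3 u), and \<open>1 - m / 3\<close> comes from sin^2 s >= m (1 - m/3). In v = -c one has 1
      - m/3 = (2 + v^2)/3.\<close>
    have poly: "K * (u / 6 + (2 - u)\<^sup>2 / 24) \<le> 3 / 10 * ((1 + 3 * u + 9 / 2 * u\<^sup>2) * ((2 - u)\<^sup>2 * (1 - m / 3)\<^sup>2))"
    proof -
      have vp: "v ^ 2 \<le> v" "v ^ 3 \<le> v" "0 \<le> v ^ 4" using v
        by (auto simp: power2_eq_square power3_eq_cube mult_le_one intro!: mult_left_le_one_le)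
      have "0 \<le> v ^ 4 * (v - 1)\<^sup>2" "0 \<le> v ^ 3 * (v - 1)\<^sup>2" using v by auto
      hence v56: "2 * v ^ 5 - v ^ 4 \<le> v ^ 6" "2 * v ^ 4 - v ^ 3 \<le> v ^ 5"
        by (simp_all add: power2_eq_square eval_nat_numeral algebra_simps)
      have nn: "0 \<le> 17 / 2 - 12 * v + 9 / 2 * v\<^sup>2"
      proof -
        have "17 / 2 - 12 * v + 9 / 2 * v\<^sup>2 = 1 + 3 * u + 9 / 2 * u\<^sup>2"
          by (simp add: v_def power2_eq_square field_simps)
        thus ?thesis using u by simp
      qed
      have "24 * (3 / 10 * ((1 + 3 * u + 9 / 2 * u\<^sup>2) * ((2 - u)\<^sup>2 * (1 - m / 3)\<^sup>2))) =
          4 / 5 * ((17 / 2 - 12 * v + 9 / 2 * v\<^sup>2) * ((1 + v)\<^sup>2 * (2 + v\<^sup>2)\<^sup>2))"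
        unfolding u(3) v_def by (simp add: power2_eq_square field_simps)
      also have "\<dots> \<ge> 4 / 5 * ((17 / 2 - 12 * v + 9 / 2 * v\<^sup>2) * ((1 + v)\<^sup>2 * (4 + 4 * v\<^sup>2)))"
      proof -
        have "4 + 4 * v\<^sup>2 \<le> (2 + v\<^sup>2)\<^sup>2" by (simp add: power2_sum)
        thus ?thesis using nn by (intro mult_left_mono) auto
      qed
      finally have low: "4 / 5 * ((17 / 2 - 12 * v + 9 / 2 * v\<^sup>2) * ((1 + v)\<^sup>2 * (4 + 4 * v\<^sup>2))) \<le>
          24 * (3 / 10 * ((1 + 3 * u + 9 / 2 * u\<^sup>2) * ((2 - u)\<^sup>2 * (1 - m / 3)\<^sup>2)))" .
      have "4 / 5 * ((17 / 2 - 12 * v + 9 / 2 * v\<^sup>2) * ((1 + v)\<^sup>2 * (4 + 4 * v\<^sup>2))) - K * (5 - 2 * v + v\<^sup>2) =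
          (136 / 5 - 5 * K) + (16 + 2 * K) * v + (- 8 - K) * v ^ 2 + 32 / 5 * v ^ 3 - 104 / 5 * v ^ 4 - 48 / 5 * v ^ 5 + 72 / 5 * v ^ 6"
        by (simp add: power2_eq_square eval_nat_numeral field_simps)
      moreover have "0 \<le> (136 / 5 - 5 * K) + (16 + 2 * K) * v + (- 8 - K) * v ^ 2 + 32 / 5 * v ^ 3 - 104 / 5 * v ^ 4 - 48 / 5 * v ^ 5 + 72 / 5 * v ^ 6"
      proof -
        \<comment> \<open>Treating the powers of v as independent quantities makes the claim linear:
          eliminating \<open>p6\<close>, then \<open>p5\<close>, leaves a positive coefficient at
          \<open>p4\<close>, and \<open>p2\<close> and \<open>p3\<close> are bounded by v.\<close>
        have "0 \<le> (136 / 5 - 5 * K) + (16 + 2 * K) * v + (- 8 - K) * p2 + 32 / 5 * p3 - 104 / 5 * p4 - 48 / 5 * p5 + 72 / 5 * p6"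
          if "2 * p5 - p4 \<le> p6" "2 * p4 - p3 \<le> p5" "p2 \<le> v" "p3 \<le> v" "0 \<le> p4" for p2 p3 p4 p5 p6
          using that v unfolding K_def by (simp add: field_simps)
        thus ?thesis using v56 vp by blast
      qed
      ultimately have "K * (5 - 2 * v + v\<^sup>2) \<le> 4 / 5 * ((17 / 2 - 12 * v + 9 / 2 * v\<^sup>2) * ((1 + v)\<^sup>2 * (4 + 4 * v\<^sup>2)))"
        by linarith
      moreover have "24 * (K * (u / 6 + (2 - u)\<^sup>2 / 24)) = K * (5 - 2 * v + v\<^sup>2)"
        unfolding v_def by (simp add: power2_eq_square field_simps)
      ultimately show ?thesis using low by linarith
    qed
    define E where "E = exp (- 1 :: real)"
    define D where "D = exp 1 - (1 :: real)"
    have D: "0 \<le> D" "D ^ 3 \<le> K"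
    proof -
      show "0 \<le> D" using exp_ge_add_one_self[of 1] by (simp add: D_def)
      hence "D ^ 3 \<le> (172 / 100) ^ 3" using e_less_272 by (intro power_mono) (auto simp: D_def)
      thus "D ^ 3 \<le> K" by (simp add: K_def power3_eq_cube)
    qed
    have ED: "\<delta> = E * D" "exp c = E * exp u" "0 < E"
      by (auto simp: \<delta>_def E_def D_def u_def algebra_simps simp flip: exp_add)
    have "D ^ 3 * (exp u * cos s - 1) \<le> D ^ 3 * (exp u * (u ^ 3 / 6 + m\<^sup>2 / 24))"
      using cos_u D by (intro mult_left_mono) auto
    also have "\<dots> \<le> K * (exp u * (u ^ 3 / 6 + m\<^sup>2 / 24))"
      using D u by (intro mult_right_mono) auto
    also have "\<dots> = exp u * u\<^sup>2 * (K * (u / 6 + (2 - u)\<^sup>2 / 24))"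
      unfolding u(3) by (simp add: power2_eq_square power3_eq_cube algebra_simps)
    also have "\<dots> \<le> exp u * u\<^sup>2 * (3 / 10 * ((1 + 3 * u + 9 / 2 * u\<^sup>2) * ((2 - u)\<^sup>2 * (1 - m / 3)\<^sup>2)))"
      using poly by (intro mult_left_mono) auto
    also have "\<dots> \<le> exp u * u\<^sup>2 * (3 / 10 * (exp (3 * u) * ((2 - u)\<^sup>2 * (1 - m / 3)\<^sup>2)))"
    proof -
      have "1 + 3 * u + 9 / 2 * u\<^sup>2 \<le> exp (3 * u)"
        using exp_lower_Taylor_quadratic[of "3 * u"] u by (simp add: power_mult_distrib)
      thus ?thesis by (intro mult_left_mono mult_right_mono) auto
    qed
    also have "\<dots> = 3 / 10 * exp u ^ 4 * (m * (1 - m / 3))\<^sup>2"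
    proof -
      have "exp u ^ 4 = exp u * exp (3 * u)"
        by (simp flip: exp_of_nat_mult exp_add)
      thus ?thesis unfolding u(3) by (simp add: power_mult_distrib)
    qed
    also have "\<dots> \<le> 3 / 10 * exp u ^ 4 * ((sin s)\<^sup>2)\<^sup>2"
    proof -
      have "m * (1 - m / 3) \<le> m * (1 - m / 6)\<^sup>2"
        using m by (intro mult_left_mono) (auto simp: power2_eq_square algebra_simps)
      hence "m * (1 - m / 3) \<le> (sin s)\<^sup>2" using sin2 by simp
      moreover have "0 \<le> m * (1 - m / 3)" using m(1,2) by simp
      ultimately show ?thesis by (intro mult_left_mono power_mono) auto
    qed
    also have "((sin s)\<^sup>2)\<^sup>2 = sin s ^ 4" by simp
    \<comment> \<open>The factor E^4 restores the original scale: as E = 1 - \<delta>, the left side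
      becomes \<delta>^3 (exp c cos s - 1 + \<delta>).\<close>
    finally have "E ^ 4 * (D ^ 3 * (exp u * cos s - 1)) \<le> E ^ 4 * (3 / 10 * exp u ^ 4 * sin s ^ 4)"
      using ED by (intro mult_left_mono) auto
    moreover have "E * exp 1 = 1" by (simp add: E_def flip: exp_add)
    hence "E ^ 4 * (D ^ 3 * (exp u * cos s - 1)) = \<delta> ^ 4 - \<delta> ^ 3 * (1 - exp c * cos s)"
      unfolding ED D_def by (simp add: power3_eq_cube power4_eq_xxxx) algebra
    moreover have "\<delta> ^ 3 * (1 - exp c * cos s) \<le> \<delta> ^ 3 * \<bar>exp c * cos s - 1\<bar>"
      using ED D by (intro mult_left_mono) auto
    ultimately have "\<delta> ^ 4 \<le> \<delta> ^ 3 * \<bar>exp c * cos s - 1\<bar> + 3 / 10 * (exp c * sin s) ^ 4"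
      unfolding ED by (simp add: power_mult_distrib)
    thus ?thesis ..
  qed
qed

text \<open>The disc test works for small c and the strip for c near 1. In between, for instance at
  c = 18/25, both fail and the fourth power is needed.\<close>

lemma sin_boundary_ineq:
  fixes c s :: real
  assumes cs: "c\<^sup>2 + s\<^sup>2 = 1" and c: "0 \<le> c" and s: "0 \<le> s"
  defines "ch \<equiv> (exp s + exp (- s)) / 2" and "sh \<equiv> (exp s - exp (- s)) / 2" and "\<delta> \<equiv> sin 1"
  shows "(5 / 4 * \<delta>)\<^sup>2 \<le> (sin c * ch)\<^sup>2 + (cos c * sh)\<^sup>2 \<or>
    \<delta> ^ 4 \<le> \<delta> ^ 3 * (sin c * ch) + 3 / 10 * (cos c * sh) ^ 4"
proof -
  define n where "n = c\<^sup>2"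
  have s2: "s\<^sup>2 = 1 - n" using cs by (simp add: n_def)
  have n: "0 \<le> n" "n \<le> 1" using s2 by (auto simp: n_def) (smt (verit) zero_le_power2)
  have c1: "c \<le> 1" using n c by (simp add: n_def abs_square_le_1)
  have \<delta>: "0 < \<delta>" "\<delta> \<le> 8417 / 10000"
    using sin_gt_zero[of 1] pi_gt3 sin_le_taylor5[of 1] by (auto simp: \<delta>_def)
  have chsh: "ch\<^sup>2 = 1 + sh\<^sup>2"
    by (simp add: ch_def sh_def power2_eq_square field_simps flip: exp_add)
  have ch: "(3 - n) / 2 \<le> ch"
    using cosh_ge_taylor2[of s] s2 by (simp add: ch_def)
  have "s * ((7 - n) / 6) = s + s ^ 3 / 6"
    using s2 by (simp add: power3_eq_cube power2_eq_square field_simps) algebra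
  hence sh: "s * ((7 - n) / 6) \<le> sh"
    using sinh_ge_taylor3[OF s] by (simp add: sh_def)
  have "(s * ((7 - n) / 6))\<^sup>2 \<le> sh\<^sup>2"
    using sh s n by (intro power_mono) auto
  hence sh2: "(1 - n) * ((7 - n) / 6)\<^sup>2 \<le> sh\<^sup>2"
    by (simp only: power_mult_distrib s2)
  have sinc: "c * (1 - n / 6) \<le> sin c"
    using sin_ge_taylor3[OF c] by (simp add: n_def power3_eq_cube power2_eq_square algebra_simps)
  have sinc0: "0 \<le> c * (1 - n / 6)" using c n by simp
  have cosc: "1 - n / 2 \<le> cos c" using cos_ge_taylor2[of c] by (simp add: n_def)
  have X: "c * (1 - n / 6) * ((3 - n) / 2) \<le> sin c * ch"
    using sinc sinc0 ch n by (intro mult_mono) auto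
  consider "n \<le> 1 / 3" | "1 / 3 < n" "c < 87 / 100" | "87 / 100 \<le> c" by linarith
  thus ?thesis
  proof cases
    case 1
    \<comment> \<open>The squared modulus of sin is sin^2 c + sinh^2 s, which avoids estimating the
      two products separately.\<close>
    have "(S * ch)\<^sup>2 + (C * sh)\<^sup>2 = S\<^sup>2 + sh\<^sup>2 * (S\<^sup>2 + C\<^sup>2)" for S C
      unfolding power_mult_distrib chsh by (simp add: algebra_simps)
    hence norm_eq: "(sin c * ch)\<^sup>2 + (cos c * sh)\<^sup>2 = (sin c)\<^sup>2 + sh\<^sup>2" by simp
    have "(c * (1 - n / 6))\<^sup>2 \<le> (sin c)\<^sup>2" using sinc sinc0 by (intro power_mono) auto
    hence sin2: "n * (1 - n / 6)\<^sup>2 \<le> (sin c)\<^sup>2" by (simp add: power_mult_distrib n_def)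
    have "n * (1 - n / 6)\<^sup>2 + (1 - n) * ((7 - n) / 6)\<^sup>2 = 49 / 36 - 3 / 4 * n + n\<^sup>2 / 12"
      by (simp add: power2_eq_square field_simps)
    hence "49 / 36 - 3 / 4 * n \<le> n * (1 - n / 6)\<^sup>2 + (1 - n) * ((7 - n) / 6)\<^sup>2" by simp
    moreover have "(5 / 4 * \<delta>)\<^sup>2 \<le> (5 / 4 * (8417 / 10000))\<^sup>2" using \<delta> by (intro power_mono) auto
    moreover have "(5 / 4 * (8417 / 10000))\<^sup>2 \<le> (49 / 36 - 1 / 4 :: real)" by (simp add: power2_eq_square)
    ultimately have "(5 / 4 * \<delta>)\<^sup>2 \<le> (sin c)\<^sup>2 + sh\<^sup>2" using sin2 sh2 1 by linarith
    thus ?thesis unfolding norm_eq ..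
  next
    case 2
    \<comment> \<open>About the midpoint of the range of c. Powers of x are then small, and the
      constant term of the polynomial below, about 0.0114, outweighs the lower bound -1/100 for the
      other terms up to degree three.\<close>
    define x where "x = c - 18 / 25"
    have c_low: "577 / 1000 < c"
    proof (rule ccontr)
      assume "\<not> ?thesis"
      hence "c\<^sup>2 \<le> (577 / 1000)\<^sup>2" using c by (intro power_mono) auto
      thus False using 2 by (simp add: n_def power2_eq_square)
    qed
    have n_up: "n \<le> 76 / 100"
    proof -
      have "c\<^sup>2 \<le> (87 / 100)\<^sup>2" using c 2 by (intro power_mono) auto
      thus ?thesis by (simp add: n_def power2_eq_square)
    qed
    define Y where "Y = (cos c * sh)\<^sup>2"
    have "(1 - n / 2)\<^sup>2 * ((1 - n) * ((7 - n) / 6)\<^sup>2) \<le> (cos c)\<^sup>2 * sh\<^sup>2"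
      using sh2 cosc n by (intro mult_mono power_mono) auto
    \<comment> \<open>The line is nearly the tangent at n = 1/2, lowered by about 1/100. It is still
      positive at n = 76/100, so it may be squared afterwards.\<close>
    moreover have "23 / 25 - 6 / 5 * n \<le> (1 - n / 2)\<^sup>2 * ((1 - n) * ((7 - n) / 6)\<^sup>2)"
    proof -
      define y where "y = n - 1 / 2"
      have y: "- (1 / 2) \<le> y" "y \<le> 1 / 2" using n by (auto simp: y_def)
      have "0 \<le> y\<^sup>2 * (791 / 576 - 61 / 96 * y + (11 / 96 - y / 144) * y\<^sup>2)"
        using y by (intro mult_nonneg_nonneg add_nonneg_nonneg) auto
      moreover have "(1 - (y + 1 / 2) / 2)\<^sup>2 * ((1 - (y + 1 / 2)) * ((7 - (y + 1 / 2)) / 6)\<^sup>2)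
          - (23 / 25 - 6 / 5 * (y + 1 / 2)) =
          129 / 12800 - 7 / 3840 * y + y\<^sup>2 * (791 / 576 - 61 / 96 * y + (11 / 96 - y / 144) * y\<^sup>2)"
        by (simp add: power2_eq_square field_simps)
      moreover have "y + 1 / 2 = n" by (simp add: y_def)
      ultimately have "(1 - n / 2)\<^sup>2 * ((1 - n) * ((7 - n) / 6)\<^sup>2) - (23 / 25 - 6 / 5 * n) =
          129 / 12800 - 7 / 3840 * y + y\<^sup>2 * (791 / 576 - 61 / 96 * y + (11 / 96 - y / 144) * y\<^sup>2)"
        and "0 \<le> y\<^sup>2 * (791 / 576 - 61 / 96 * y + (11 / 96 - y / 144) * y\<^sup>2)"
        by simp_all
      thus ?thesis using y by linarith
    qed
    ultimately have Y: "23 / 25 - 6 / 5 * n \<le> Y" by (simp add: Y_def power_mult_distrib)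
    have Y2: "(23 / 25 - 6 / 5 * n)\<^sup>2 \<le> Y\<^sup>2" using Y n_up by (intro power_mono) auto
    have Y4: "Y\<^sup>2 = (cos c * sh) ^ 4" by (simp add: Y_def)
    define A where "A = c * (1 - n / 6) * ((3 - n) / 2)"
    have XA: "A \<le> sin c * ch" using X by (simp only: A_def)
    have poly: "597 / 1000 * (8417 / 10000 - A) \<le> 3 / 10 * (23 / 25 - 6 / 5 * n)\<^sup>2"
    proof -
      have x: "- (143 / 1000) \<le> x" "x \<le> 3 / 20" using c_low 2 by (auto simp: x_def)
      define R where "R = (6111 / 10000 + 199 / 4000 * x) * x ^ 4"
      have R: "0 \<le> R" using x by (auto simp: R_def)
      have c_eq: "c = x + 18 / 25" by (simp add: x_def)
      have "3 / 10 * (23 / 25 - 6 / 5 * n)\<^sup>2 - 597 / 1000 * (8417 / 10000 - A) =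
          1780690803 / 156250000000 +
          x * (- (6699303 / 156250000) + x * (- (625977 / 6250000) + 527157 / 500000 * x)) + R"
        unfolding A_def n_def c_eq R_def by (simp add: power2_eq_square power4_eq_xxxx field_simps)
      moreover have "- (1 / 100) \<le>
          x * (- (6699303 / 156250000) + x * (- (625977 / 6250000) + 527157 / 500000 * x))"
      proof (cases "0 \<le> x")
        case True
        have "x * (- (1 / 15)) \<le>
          x * (- (6699303 / 156250000) + x * (- (625977 / 6250000) + 527157 / 500000 * x))"
        proof (intro mult_left_mono True)
          have "x * (- (3 / 20)) \<le> x * (- (625977 / 6250000) + 527157 / 500000 * x)"
            using True by (intro mult_left_mono) auto
          thus "- (1 / 15) \<le> - (6699303 / 156250000) + x * (- (625977 / 6250000) + 527157 / 500000 * x)"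
            using x by linarith
        qed
        thus ?thesis using x by linarith
      next
        case False
        have "(- x) * - (- (625977 / 6250000) + 527157 / 500000 * x) \<le> 143 / 1000 * (1 / 4 + 1 / 500)"
          using False x by (intro mult_mono) auto
        hence "x * (- (625977 / 6250000) + 527157 / 500000 * x) \<le> 143 / 1000 * (1 / 4 + 1 / 500)"
          by (simp only: minus_mult_minus)
        from add_left_mono[OF this, of "- (6699303 / 156250000)"]
        have "- (6699303 / 156250000) + x * (- (625977 / 6250000) + 527157 / 500000 * x) \<le> 0"
          by (rule order_trans) simp
        hence "0 \<le> x * (- (6699303 / 156250000) + x * (- (625977 / 6250000) + 527157 / 500000 * x))"
          using False by (intro mult_nonpos_nonpos) auto
        thus ?thesis by linarith
      qed
      ultimately show ?thesis using R by linarith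
    qed
    have "\<delta> ^ 3 * (\<delta> - sin c * ch) \<le> 3 / 10 * Y\<^sup>2"
    proof (cases "\<delta> \<le> sin c * ch")
      case True
      hence "\<delta> ^ 3 * (\<delta> - sin c * ch) \<le> 0" using \<delta> by (simp add: mult_nonneg_nonpos)
      moreover have "0 \<le> 3 / 10 * Y\<^sup>2" by simp
      ultimately show ?thesis by linarith
    next
      case False
      have "\<delta> ^ 3 \<le> (8417 / 10000) ^ 3" using \<delta> by (intro power_mono) auto
      also have "\<dots> \<le> 597 / 1000" by (simp add: power3_eq_cube)
      finally have "\<delta> ^ 3 * (\<delta> - sin c * ch) \<le> 597 / 1000 * (8417 / 10000 - A)"
        using False \<delta> XA by (intro mult_mono) auto
      thus ?thesis using poly Y2 by linarith
    qed
    hence "\<delta> ^ 4 \<le> \<delta> ^ 3 * (sin c * ch) + 3 / 10 * (cos c * sh) ^ 4"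
    proof -
      have "\<delta> ^ 4 = \<delta> ^ 3 * \<delta>" by (simp add: power3_eq_cube power4_eq_xxxx)
      with \<open>\<delta> ^ 3 * (\<delta> - sin c * ch) \<le> 3 / 10 * Y\<^sup>2\<close> show ?thesis
        unfolding Y4 right_diff_distrib by linarith
    qed
    thus ?thesis ..
  next
    case 3
    \<comment> \<open>The loss sin 1 - sin c is compared with the gain from cosh s >= 1 + (1 - c)(1
      + c)/2. Both contain 1 - c, so 2 cos c <= (1 + c) sin c is enough.\<close>
    have mvt: "\<delta> - sin c \<le> (1 - c) * cos c"
    proof (cases "c = 1")
      case False
      then obtain z where z: "c < z" "z < 1" "sin 1 - sin c = (1 - c) * cos z"
        using MVT2[of c 1 sin cos] c1 by (auto intro: DERIV_sin)
      moreover have "cos z \<le> cos c"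
        using z c pi_gt3 by (intro cos_monotone_0_pi_le) auto
      ultimately show ?thesis using c1 by (simp add: \<delta>_def mult_left_mono)
    qed (simp add: \<delta>_def)
    have "2 * cos c \<le> sin c * (1 + c)"
    proof -
      have n3: "(87 / 100)\<^sup>2 \<le> n" unfolding n_def using 3 by (intro power_mono) auto
      have "c * n \<le> n" using c c1 n by (simp add: mult_left_le_one_le)
      moreover have "n\<^sup>2 \<le> n" using n by (simp add: power2_eq_square mult_left_le_one_le)
      moreover have "7569 / 10000 \<le> n" using n3 by (simp add: power2_eq_square)
      ultimately have "2 - n + n\<^sup>2 / 12 \<le> c + n - c * n / 6 - n\<^sup>2 / 6" using 3 by linarith
      moreover have "c + n - c * n / 6 - n\<^sup>2 / 6 = c * (1 - n / 6) * (1 + c)"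
        by (simp add: n_def power2_eq_square algebra_simps)
      ultimately have "2 * (1 - n / 2 + n\<^sup>2 / 24) \<le> c * (1 - n / 6) * (1 + c)" by simp
      moreover have "2 * cos c \<le> 2 * (1 - n / 2 + n\<^sup>2 / 24)"
        using cos_le_taylor4[of c] by (simp add: n_def)
      moreover have "c * (1 - n / 6) * (1 + c) \<le> sin c * (1 + c)"
        using sinc c by (intro mult_right_mono) auto
      ultimately show ?thesis by (meson order_trans)
    qed
    hence "(1 - c) * (2 * cos c) \<le> (1 - c) * (sin c * (1 + c))" using c1 by (intro mult_left_mono) auto
    also have "\<dots> = sin c * (1 - n)"
      by (simp add: n_def power2_eq_square algebra_simps)
    finally have "2 * ((1 - c) * cos c) \<le> sin c * (1 - n)" by (simp only: mult.left_commute)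
    with mvt have "2 * (\<delta> - sin c) \<le> sin c * (1 - n)" by (smt (verit))
    hence "\<delta> \<le> sin c * ((3 - n) / 2)" by (simp add: algebra_simps)
    also have "\<dots> \<le> sin c * ch" using ch sinc sinc0 by (intro mult_left_mono) auto
    finally have le: "\<delta> ^ 3 * \<delta> \<le> \<delta> ^ 3 * (sin c * ch)" using \<delta> by (intro mult_left_mono) auto
    have nn: "0 \<le> 3 / 10 * (cos c * sh) ^ 4" by simp
    have "\<delta> ^ 4 \<le> \<delta> ^ 3 * (sin c * ch) + 3 / 10 * (cos c * sh) ^ 4"
    proof -
      have "\<delta> ^ 4 = \<delta> ^ 3 * \<delta>" by (simp add: power3_eq_cube power4_eq_xxxx)
      thus ?thesis using le nn by linarith
    qed
    thus ?thesis ..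
  qed
qed

section \<open>The seven majorants\<close>

text \<open>The fourth-power term is not negative, so leaving the strip suffices; five of the seven
  majorants need no more.\<close>

lemma quartic_if_strip:
  fixes \<delta> x y :: real
  assumes "0 < \<delta>" "\<delta> \<le> \<bar>x\<bar>"
  shows "\<delta> ^ 4 \<le> \<delta> ^ 3 * \<bar>x\<bar> + 3 / 10 * y ^ 4"
proof -
  have "\<delta> ^ 3 * \<delta> \<le> \<delta> ^ 3 * \<bar>x\<bar>" using assms by (intro mult_left_mono) auto
  moreover have "0 \<le> 3 / 10 * y ^ 4" by simp
  ultimately show ?thesis by (simp add: power3_eq_cube power4_eq_xxxx)
qed

lemma norm_add_less_2: "norm a < 1 \<Longrightarrow> norm b < 1 \<Longrightarrow> norm (a + b) < 2"
  for a b :: complex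
  using norm_triangle_ineq[of a b] by linarith

section \<open>Polynomial targets\<close>

lemma phi_Ne_majorant: "oval_majorant phi_Ne (2 / 3)"
proof
  show "phi_Ne holomorphic_on unit_disc" unfolding phi_Ne_def by (intro holomorphic_intros) auto
  show "continuous_on (cball 0 1) phi_Ne" unfolding phi_Ne_def by (intro continuous_intros) auto
  show "inj_on phi_Ne unit_disc"
  proof (rule inj_onI)
    fix a b assume ab: "a \<in> unit_disc" "b \<in> unit_disc" and eq: "phi_Ne a = phi_Ne b"
    have "norm (a\<^sup>2 + a * b + b\<^sup>2) \<le> norm a ^ 2 + norm a * norm b + norm b ^ 2"
      by (metis (no_types, lifting) norm_add_rule_thm norm_mult norm_power order.refl)
    moreover have "norm a ^ 2 < 1" "norm b ^ 2 < 1" using ab by (auto simp: abs_square_less_1)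
    moreover have "norm a * norm b \<le> 1 * 1" using ab by (intro mult_mono) auto
    ultimately have "norm (a\<^sup>2 + a * b + b\<^sup>2) < 3" by linarith
    hence "a\<^sup>2 + a * b + b\<^sup>2 \<noteq> 3" by auto
    moreover have "(a - b) * (3 - (a\<^sup>2 + a * b + b\<^sup>2)) = 3 * (phi_Ne a - phi_Ne b)"
      by (simp add: phi_Ne_def field_simps power2_eq_square power3_eq_cube)
    ultimately show "a = b" using eq by simp
  qed
  fix t :: real assume t: "-1 < t" "t < 1"
  have "0 \<le> (2 - t) * (t + 1)\<^sup>2" using t by simp
  thus "1 - 2 / 3 \<le> Re (phi_Ne (of_real t))"
    by (simp add: phi_Ne_def power2_eq_square power3_eq_cube algebra_simps)
next
  fix \<zeta> :: complex assume \<zeta>: "norm \<zeta> = 1"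
  define m where "m = (Im \<zeta>)\<^sup>2"
  have phi: "phi_Ne \<zeta> - 1 = nephroid \<zeta>" by (simp add: phi_Ne_def nephroid_def)
  have n: "(norm (nephroid \<zeta>))\<^sup>2 = 4 / 9 + 4 / 3 * m" "(Im (nephroid \<zeta>))\<^sup>2 = m * (4 / 3 * m)\<^sup>2"
    using nephroid_parts[of 1 \<zeta>] \<zeta> by (simp_all add: m_def)
  have m: "0 \<le> m" by (simp add: m_def)
  show "5 / 4 * (2 / 3) \<le> norm (phi_Ne \<zeta> - 1) \<or>
      (2 / 3) ^ 4 \<le> (2 / 3) ^ 3 * \<bar>Re (phi_Ne \<zeta> - 1)\<bar> + 3 / 10 * Im (phi_Ne \<zeta> - 1) ^ 4"
  \<comment> \<open>At m = 3/16 the squared modulus 4/9 + 4/3 m equals (5/6)^2, the radius of the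
    disc test.\<close>
  proof (cases "m \<le> 3 / 16")
    case True
    have "(Re (nephroid \<zeta>))\<^sup>2 = 4 / 9 + 4 / 3 * m - m * (4 / 3 * m)\<^sup>2"
      using n cmod_power2[of "nephroid \<zeta>"] by simp
    also have "\<dots> = 4 / 9 + 4 / 3 * m * (1 - 4 / 3 * m\<^sup>2)" by (simp add: power2_eq_square algebra_simps)
    also have "\<dots> \<ge> 4 / 9"
    proof -
      have "m\<^sup>2 \<le> (3 / 16)\<^sup>2" using True m by (intro power_mono) auto
      thus ?thesis using m by (simp add: power2_eq_square)
    qed
    finally have "(2 / 3)\<^sup>2 \<le> \<bar>Re (nephroid \<zeta>)\<bar>\<^sup>2" by (simp add: power2_eq_square)
    hence "2 / 3 \<le> \<bar>Re (nephroid \<zeta>)\<bar>" by (rule power2_le_imp_le) simp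
    thus ?thesis unfolding phi by (intro disjI2 quartic_if_strip) auto
  next
    case False
    hence "(5 / 4 * (2 / 3))\<^sup>2 \<le> (norm (nephroid \<zeta>))\<^sup>2" by (simp only: n) (simp add: power2_eq_square)
    hence "5 / 4 * (2 / 3) \<le> norm (nephroid \<zeta>)" by (rule power2_le_imp_le) simp
    thus ?thesis unfolding phi ..
  qed
qed (auto simp: phi_Ne_def)

lemma phi_C_majorant: "oval_majorant phi_C (2 / 3)"
proof
  show "phi_C holomorphic_on unit_disc" unfolding phi_C_def by (intro holomorphic_intros) auto
  show "continuous_on (cball 0 1) phi_C" unfolding phi_C_def by (intro continuous_intros) auto
  show "inj_on phi_C unit_disc"
  proof (rule inj_onI)
    fix a b assume ab: "a \<in> unit_disc" "b \<in> unit_disc" and eq: "phi_C a = phi_C b"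
    have "norm (a + b) < 2" using ab by (intro norm_add_less_2) auto
    hence "a + b \<noteq> - 2" by auto
    hence "a + b + 2 \<noteq> 0" by (simp add: eq_neg_iff_add_eq_0)
    moreover have "(a - b) * (a + b + 2) = 3 / 2 * (phi_C a - phi_C b)"
      by (simp add: phi_C_def field_simps power2_eq_square)
    ultimately show "a = b" using eq by simp
  qed
  fix t :: real assume t: "-1 < t" "t < 1"
  have "0 \<le> (t + 1)\<^sup>2" by simp
  thus "1 - 2 / 3 \<le> Re (phi_C (of_real t))"
    by (simp add: phi_C_def power2_eq_square algebra_simps)
next
  fix \<zeta> :: complex assume \<zeta>: "norm \<zeta> = 1"
  define c where "c = Re \<zeta>"
  have s2: "(Im \<zeta>)\<^sup>2 = 1 - c\<^sup>2" using \<zeta> cmod_power2[of \<zeta>] by (simp add: c_def)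
  have c: "-1 \<le> c" using abs_Re_le_cmod[of \<zeta>] \<zeta> by (auto simp: c_def)
  show "5 / 4 * (2 / 3) \<le> norm (phi_C \<zeta> - 1) \<or>
      (2 / 3) ^ 4 \<le> (2 / 3) ^ 3 * \<bar>Re (phi_C \<zeta> - 1)\<bar> + 3 / 10 * Im (phi_C \<zeta> - 1) ^ 4"
  \<comment> \<open>The real part is -2/3 + 4/3 c (c + 1) and crosses the strip boundary at c = 0;
    for c > 0 the modulus is at least 4/3.\<close>
  proof (cases "c \<le> 0")
    case True
    have "Re (phi_C \<zeta> - 1) = 4 / 3 * c + 2 / 3 * (c\<^sup>2 - (Im \<zeta>)\<^sup>2)"
      by (simp add: phi_C_def c_def power2_eq_square)
    also have "\<dots> = - (2 / 3) + 4 / 3 * (c * (c + 1))"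
      unfolding s2 by (simp add: power2_eq_square algebra_simps)
    finally have "Re (phi_C \<zeta> - 1) = - (2 / 3) + 4 / 3 * (c * (c + 1))" .
    moreover have "c * (c + 1) \<le> 0" using True c by (intro mult_nonpos_nonneg) auto
    ultimately have "2 / 3 \<le> \<bar>Re (phi_C \<zeta> - 1)\<bar>" by linarith
    thus ?thesis by (intro disjI2 quartic_if_strip) auto
  next
    case False
    have eq: "phi_C \<zeta> - 1 = of_real (2 / 3) * (\<zeta> * (2 + \<zeta>))"
      by (simp add: phi_C_def power2_eq_square field_simps)
    have "norm (phi_C \<zeta> - 1) = 2 / 3 * norm (2 + \<zeta>)"
      unfolding eq by (simp only: norm_mult \<zeta>) simp
    moreover have "2 \<le> norm (2 + \<zeta>)"
      using complex_Re_le_cmod[of "2 + \<zeta>"] False by (simp add: c_def)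
    ultimately show ?thesis by simp
  qed
qed (auto simp: phi_C_def)

lemma sqrt_2_bounds: "7 / 5 < sqrt 2" "sqrt 2 < 3 / 2"
proof -
  show "7 / 5 < sqrt 2" by (rule real_less_rsqrt) (simp add: power2_eq_square)
  show "sqrt 2 < 3 / 2" by (rule real_less_lsqrt) (simp_all add: power2_eq_square)
qed

lemma phi_lim_majorant: "oval_majorant phi_lim (sqrt 2 - 1 / 2)"
proof
  note s2 = sqrt_2_bounds
  show "0 < sqrt 2 - 1 / 2" using s2 by simp
  show "phi_lim holomorphic_on unit_disc" unfolding phi_lim_def by (intro holomorphic_intros) auto
  show "continuous_on (cball 0 1) phi_lim" unfolding phi_lim_def by (intro continuous_intros) auto
  show "inj_on phi_lim unit_disc"
  proof (rule inj_onI)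
    fix a b assume ab: "a \<in> unit_disc" "b \<in> unit_disc" and eq: "phi_lim a = phi_lim b"
    have "norm (a + b) < 2" using ab by (intro norm_add_less_2) auto
    moreover have "norm (- of_real (2 * sqrt 2) :: complex) = 2 * sqrt 2"
      by (simp only: norm_minus_cancel norm_of_real) simp
    ultimately have "a + b \<noteq> - of_real (2 * sqrt 2)" using s2 by auto
    hence "a + b + of_real (2 * sqrt 2) \<noteq> 0" by (simp add: eq_neg_iff_add_eq_0)
    moreover have "(a - b) * (a + b + of_real (2 * sqrt 2)) = 2 * (phi_lim a - phi_lim b)"
      by (simp add: phi_lim_def field_simps power2_eq_square)
    ultimately show "a = b" using eq by simp
  qed
  fix t :: real assume t: "-1 < t" "t < 1"
  have "0 \<le> (t + 1) * (sqrt 2 - (1 - t) / 2)" using t s2 by (intro mult_nonneg_nonneg) auto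
  thus "1 - (sqrt 2 - 1 / 2) \<le> Re (phi_lim (of_real t))"
    by (simp add: phi_lim_def power2_eq_square field_simps)
next
  fix \<zeta> :: complex assume \<zeta>: "norm \<zeta> = 1"
  define r where "r = sqrt 2"
  define c where "c = Re \<zeta>"
  have r: "7 / 5 < r" "r < 3 / 2" "r * r = 2"
    using sqrt_2_bounds by (simp_all add: r_def)
  have s2: "(Im \<zeta>)\<^sup>2 = 1 - c\<^sup>2" using \<zeta> cmod_power2[of \<zeta>] by (simp add: c_def)
  have c: "-1 \<le> c" using abs_Re_le_cmod[of \<zeta>] \<zeta> by (auto simp: c_def)
  have "5 / 4 * (r - 1 / 2) \<le> norm (phi_lim \<zeta> - 1) \<or>
      (r - 1 / 2) ^ 4 \<le> (r - 1 / 2) ^ 3 * \<bar>Re (phi_lim \<zeta> - 1)\<bar> + 3 / 10 * Im (phi_lim \<zeta> - 1) ^ 4"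
  \<comment> \<open>The split is the second zero, besides -1, of the real part plus \<delta>. There
    the squared modulus 9/4 + r c has the value 1/4 + r, above (5/4)^2.\<close>
  proof (cases "c \<le> 1 - r")
    case True
    have "Re (phi_lim \<zeta> - 1) = r * c + 1 / 2 * (c\<^sup>2 - (Im \<zeta>)\<^sup>2)"
      by (simp add: phi_lim_def c_def r_def power2_eq_square)
    also have "\<dots> = - (r - 1 / 2) + (c + 1) * (c - (1 - r))"
      unfolding s2 by (simp add: power2_eq_square algebra_simps)
    finally have "Re (phi_lim \<zeta> - 1) = - (r - 1 / 2) + (c + 1) * (c - (1 - r))" .
    moreover have "(c + 1) * (c - (1 - r)) \<le> 0" using True c by (intro mult_nonneg_nonpos) auto
    ultimately have "r - 1 / 2 \<le> \<bar>Re (phi_lim \<zeta> - 1)\<bar>" by linarith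
    thus ?thesis using r by (intro disjI2 quartic_if_strip) auto
  next
    case False
    have eq: "phi_lim \<zeta> - 1 = \<zeta> * (of_real r + \<zeta> / 2)"
      by (simp add: phi_lim_def r_def power2_eq_square field_simps)
    have "(norm (phi_lim \<zeta> - 1))\<^sup>2 = (r + c / 2)\<^sup>2 + (Im \<zeta> / 2)\<^sup>2"
      unfolding eq norm_mult \<zeta> by (simp add: cmod_power2 c_def)
    also have "\<dots> = r * r + r * c + 1 / 4"
      using s2 by (simp add: power2_eq_square field_simps)
    finally have n: "(norm (phi_lim \<zeta> - 1))\<^sup>2 = 9 / 4 + r * c" using r by simp
    have "r * (1 - r) \<le> r * c" using False r by (intro mult_left_mono) auto
    hence "1 / 4 + r \<le> 9 / 4 + r * c" using r by (simp add: algebra_simps)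
    moreover have "(5 / 4 * (r - 1 / 2))\<^sup>2 \<le> (5 / 4)\<^sup>2" using r by (intro power_mono) auto
    ultimately have "(5 / 4 * (r - 1 / 2))\<^sup>2 \<le> (norm (phi_lim \<zeta> - 1))\<^sup>2"
      unfolding n using r by (simp add: power2_eq_square[of "5/4"])
    hence "5 / 4 * (r - 1 / 2) \<le> norm (phi_lim \<zeta> - 1)" by (rule power2_le_imp_le) simp
    thus ?thesis ..
  qed
  thus "5 / 4 * (sqrt 2 - 1 / 2) \<le> norm (phi_lim \<zeta> - 1) \<or>
      (sqrt 2 - 1 / 2) ^ 4 \<le> (sqrt 2 - 1 / 2) ^ 3 * \<bar>Re (phi_lim \<zeta> - 1)\<bar> + 3 / 10 * Im (phi_lim \<zeta> - 1) ^ 4"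
    unfolding r_def .
qed (auto simp: phi_lim_def)

section \<open>Exponential and sine\<close>

lemma exp_majorant: "oval_majorant exp (1 - exp (- 1))"
proof
  show "inj_on exp unit_disc"
  proof (rule inj_onI)
    fix a b :: complex assume ab: "a \<in> unit_disc" "b \<in> unit_disc" and eq: "exp a = exp b"
    have "\<bar>Im a - Im b\<bar> < 2 * pi"
      using abs_Im_le_cmod[of a] abs_Im_le_cmod[of b] ab pi_gt3 by simp
    thus "a = b" using eq by (rule exp_complex_eqI)
  qed
next
  fix \<zeta> :: complex assume \<zeta>: "norm \<zeta> = 1"
  define c s where "c = Re \<zeta>" and "s = Im \<zeta>"
  have cs: "c\<^sup>2 + s\<^sup>2 = 1" using \<zeta> cmod_power2[of \<zeta>] by (simp add: c_def s_def)
  have parts: "Re (exp \<zeta> - 1) = exp c * cos s - 1" "Im (exp \<zeta> - 1) = exp c * sin s"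
    by (simp_all add: Re_exp Im_exp c_def s_def)
  have "(exp c * C - 1)\<^sup>2 + (exp c * S)\<^sup>2 = (exp c - C)\<^sup>2 + S\<^sup>2 + (exp c ^ 2 - 1) * (S\<^sup>2 + C\<^sup>2 - 1)" for C S
    by (simp add: power2_eq_square algebra_simps)
  hence n: "(norm (exp \<zeta> - 1))\<^sup>2 = (exp c - cos s)\<^sup>2 + (sin s)\<^sup>2"
    unfolding cmod_power2 parts by simp
  from exp_boundary_ineq[OF cs]
  show "5 / 4 * (1 - exp (- 1)) \<le> norm (exp \<zeta> - 1) \<or>
      (1 - exp (- 1)) ^ 4 \<le> (1 - exp (- 1)) ^ 3 * \<bar>Re (exp \<zeta> - 1)\<bar> + 3 / 10 * Im (exp \<zeta> - 1) ^ 4"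
    unfolding n[symmetric] parts by (auto dest: power2_le_imp_le)
qed (auto intro: holomorphic_intros continuous_intros simp: exp_cnj Re_exp)

lemma phi_sin_majorant: "oval_majorant phi_sin (sin 1)"
proof
  show "0 < sin (1 :: real)" using pi_gt3 by (intro sin_gt_zero) auto
  show "phi_sin holomorphic_on unit_disc" unfolding phi_sin_def by (intro holomorphic_intros)
  show "continuous_on (cball 0 1) phi_sin" unfolding phi_sin_def by (intro continuous_intros)
  show "inj_on phi_sin unit_disc"
  proof (rule inj_onI)
    fix a b :: complex assume ab: "a \<in> unit_disc" "b \<in> unit_disc" and eq: "phi_sin a = phi_sin b"
    have R: "\<bar>Re a\<bar> < 1" "\<bar>Re b\<bar> < 1"
      using abs_Re_le_cmod[of a] abs_Re_le_cmod[of b] ab by auto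
    have "sin a = sin b" using eq by (simp add: phi_sin_def)
    then obtain n where n: "n \<in> \<int>" "a = b + of_real (2 * n * pi) \<or> a = - b + of_real ((2 * n + 1) * pi)"
      unfolding complex_sin_eq by blast
    then obtain k where k: "n = of_int k" by (auto elim: Ints_cases)
    have *: "x = 0" if "\<bar>of_int x * pi\<bar> < 2" for x :: int
    proof (rule ccontr)
      assume "x \<noteq> 0"
      hence "1 \<le> \<bar>real_of_int x\<bar>" by linarith
      hence "1 * 3 \<le> \<bar>real_of_int x\<bar> * pi" using pi_gt3 by (intro mult_mono) auto
      thus False using that by (simp add: abs_mult)
    qed
    from n(2) show "a = b"
    proof
      assume e: "a = b + of_real (2 * n * pi)"
      hence "Re a = Re b + of_int (2 * k) * pi" by (simp add: k)
      hence "\<bar>of_int (2 * k) * pi\<bar> < 2" using R by linarith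
      from *[OF this] show ?thesis using e k by simp
    next
      assume e: "a = - b + of_real ((2 * n + 1) * pi)"
      hence "Re a = - Re b + of_int (2 * k + 1) * pi" by (simp add: k)
      hence "\<bar>of_int (2 * k + 1) * pi\<bar> < 2" using R by linarith
      from *[OF this] have False by presburger
      thus ?thesis ..
    qed
  qed
  fix t :: real assume t: "-1 < t" "t < 1"
  have "sin (- 1) \<le> sin t" using t pi_gt3 by (intro sin_monotone_2pi_le) auto
  thus "1 - sin 1 \<le> Re (phi_sin (of_real t))" by (simp add: phi_sin_def sin_of_real)
next
  fix \<zeta> :: complex assume \<zeta>: "norm \<zeta> = 1"
  \<comment> \<open>Sine commutes with reflection in both axes up to the signs of the real and
    imaginary parts, so the first quadrant suffices.\<close>
  define c s where "c = \<bar>Re \<zeta>\<bar>" and "s = \<bar>Im \<zeta>\<bar>"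
  have cs: "c\<^sup>2 + s\<^sup>2 = 1" "0 \<le> c" "0 \<le> s" using \<zeta> cmod_power2[of \<zeta>] by (simp_all add: c_def s_def)
  have "c \<le> 1" using abs_Re_le_cmod[of \<zeta>] \<zeta> by (simp add: c_def)
  hence sc: "0 \<le> sin c" using cs pi_gt3 by (intro sin_ge_zero) auto
  have "\<bar>sin (Re \<zeta>)\<bar> = \<bar>sin c\<bar>" by (simp add: c_def abs_if)
  moreover have "exp (Im \<zeta>) + exp (- Im \<zeta>) = exp s + exp (- s)"
    by (simp add: s_def abs_if add.commute)
  ultimately have re: "\<bar>Re (phi_sin \<zeta> - 1)\<bar> = sin c * ((exp s + exp (- s)) / 2)"
    using sc by (simp add: phi_sin_def Re_sin abs_mult)
  have "cos (Re \<zeta>) = cos c" by (simp add: c_def)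
  moreover have "\<bar>exp (Im \<zeta>) - exp (- Im \<zeta>)\<bar> = \<bar>exp s - exp (- s)\<bar>"
    by (auto simp: s_def abs_if)
  ultimately have "\<bar>Im (phi_sin \<zeta> - 1)\<bar> = \<bar>cos c * ((exp s - exp (- s)) / 2)\<bar>"
    by (simp add: phi_sin_def Im_sin abs_mult)
  hence im2: "(Im (phi_sin \<zeta> - 1))\<^sup>2 = (cos c * ((exp s - exp (- s)) / 2))\<^sup>2"
    by (metis power2_abs)
  hence "((Im (phi_sin \<zeta> - 1))\<^sup>2)\<^sup>2 = ((cos c * ((exp s - exp (- s)) / 2))\<^sup>2)\<^sup>2" by simp
  hence im: "Im (phi_sin \<zeta> - 1) ^ 4 = (cos c * ((exp s - exp (- s)) / 2)) ^ 4"
    by (simp only: flip: power_mult) simp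
  have n: "(norm (phi_sin \<zeta> - 1))\<^sup>2 =
      (sin c * ((exp s + exp (- s)) / 2))\<^sup>2 + (cos c * ((exp s - exp (- s)) / 2))\<^sup>2"
    unfolding cmod_power2 im2 re[symmetric] power2_abs ..
  have "(5 / 4 * sin 1)\<^sup>2 \<le> (norm (phi_sin \<zeta> - 1))\<^sup>2 \<or>
      sin 1 ^ 4 \<le> sin 1 ^ 3 * \<bar>Re (phi_sin \<zeta> - 1)\<bar> + 3 / 10 * Im (phi_sin \<zeta> - 1) ^ 4"
    using sin_boundary_ineq[OF cs] by (simp only: n re im)
  thus "5 / 4 * sin 1 \<le> norm (phi_sin \<zeta> - 1) \<or>
      sin 1 ^ 4 \<le> sin 1 ^ 3 * \<bar>Re (phi_sin \<zeta> - 1)\<bar> + 3 / 10 * Im (phi_sin \<zeta> - 1) ^ 4"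
    by (metis norm_ge_zero power2_le_imp_le)
qed (auto simp: phi_sin_def cnj_sin)


section \<open>Crescent and rational target\<close>

text \<open>It gives the inverse w -> (w^2 - 1)/(2 w), hence injectivity, and an equation for the
  boundary curve.\<close>

lemma phi_crescent_quadratic: "(phi_crescent z)\<^sup>2 - 2 * z * phi_crescent z = 1"
proof -
  have "(phi_crescent z)\<^sup>2 - 2 * z * phi_crescent z = (csqrt (1 + z\<^sup>2))\<^sup>2 - z\<^sup>2"
    by (simp add: phi_crescent_def power2_eq_square algebra_simps)
  thus ?thesis by simp
qed

text \<open>On the closed unit disc 1 + z^2 stays in the closed right half-plane, away from the
  branch cut, but it reaches the branch point 0 at z = i and z = -i.\<close>

lemma continuous_on_csqrt_right: "continuous_on {z. 0 \<le> Re z} csqrt"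
  unfolding continuous_on_eq_continuous_within
proof
  fix z :: complex assume z: "z \<in> {z. 0 \<le> Re z}"
  show "continuous (at z within {z. 0 \<le> Re z}) csqrt"
  proof (cases "z = 0")
    case True
    have "((\<lambda>w. sqrt (norm w)) \<longlongrightarrow> sqrt (norm (0 :: complex))) (at 0 within {z. 0 \<le> Re z})"
      by (intro tendsto_intros)
    hence "((\<lambda>w. norm (csqrt w)) \<longlongrightarrow> 0) (at 0 within {z. 0 \<le> Re z})" by simp
    hence "(csqrt \<longlongrightarrow> 0) (at 0 within {z. 0 \<le> Re z})" by (rule tendsto_norm_zero_cancel)
    thus ?thesis using True by (simp add: continuous_within)
  next
    case False
    hence "z \<notin> \<real>\<^sub>\<le>\<^sub>0" using z by (auto simp: complex_nonpos_Reals_iff complex_eq_iff)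
    thus ?thesis by (rule continuous_within_csqrt)
  qed
qed

lemma Re_one_plus_square: "0 < Re (1 + z\<^sup>2)" if "norm z < 1"
proof -
  have "norm (z\<^sup>2) < 1" using that by (simp add: norm_power abs_square_less_1)
  thus ?thesis using abs_Re_le_cmod[of "z\<^sup>2"] by simp
qed

lemma phi_crescent_majorant: "oval_majorant phi_crescent (2 - sqrt 2)"
proof
  note r = sqrt_2_bounds
  have nonpos: "1 + z\<^sup>2 \<notin> \<real>\<^sub>\<le>\<^sub>0" if "norm z < 1" for z :: complex
    using Re_one_plus_square[OF that] by (auto simp: complex_nonpos_Reals_iff)
  show "0 < 2 - sqrt 2" using r by simp
  show "phi_crescent holomorphic_on unit_disc"
    unfolding phi_crescent_def using nonpos by (intro holomorphic_intros) auto
  have "0 \<le> Re (1 + z\<^sup>2)" if "norm z \<le> 1" for z :: complex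
    using that abs_Re_le_cmod[of "z\<^sup>2"] power_le_one[of "norm z" 2] by (simp add: norm_power)
  hence "continuous_on (cball 0 1) (\<lambda>z. csqrt (1 + z\<^sup>2))"
    by (intro continuous_on_compose2[OF continuous_on_csqrt_right] continuous_intros) auto
  thus "continuous_on (cball 0 1) phi_crescent"
    unfolding phi_crescent_def by (intro continuous_intros)
  show "inj_on phi_crescent unit_disc"
  proof (rule inj_onI)
    fix a b assume eq: "phi_crescent a = phi_crescent b"
    have "2 * a * phi_crescent a = 2 * b * phi_crescent a"
      using phi_crescent_quadratic[of a] phi_crescent_quadratic[of b] unfolding eq
      by (simp add: algebra_simps)
    moreover have "phi_crescent a \<noteq> 0" using phi_crescent_quadratic[of a] by auto
    ultimately show "a = b" by simp
  qed
  show "phi_crescent (cnj z) = cnj (phi_crescent z)" if "norm z < 1" for z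
    using cnj_csqrt[OF nonpos[OF that]] by (simp add: phi_crescent_def)
  fix t :: real assume t: "-1 < t" "t < 1"
  have "sqrt 2 - 1 - t \<le> sqrt (1 + t\<^sup>2)"
  proof (rule real_le_rsqrt)
    have "0 \<le> 2 * ((sqrt 2 - 1) * (1 + t))" using t r by simp
    also have "\<dots> = 1 + t\<^sup>2 - (sqrt 2 - 1 - t)\<^sup>2"
      by (simp add: power2_eq_square algebra_simps)
    finally show "(sqrt 2 - 1 - t)\<^sup>2 \<le> 1 + t\<^sup>2" by simp
  qed
  moreover have "csqrt (of_real (1 + t\<^sup>2)) = of_real (sqrt (1 + t\<^sup>2))"
    by (rule csqrt_of_real) simp
  hence "Re (csqrt (1 + (of_real t)\<^sup>2)) = sqrt (1 + t\<^sup>2)" by simp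
  ultimately show "1 - (2 - sqrt 2) \<le> Re (phi_crescent (of_real t))"
    unfolding phi_crescent_def plus_complex.sel Re_complex_of_real by linarith
next
  note r = sqrt_2_bounds
  fix \<zeta> :: complex assume \<zeta>: "norm \<zeta> = 1"
  define w where "w = phi_crescent \<zeta>"
  define x y where "x = Re w" and "y = Im w"
  have "w\<^sup>2 - 1 = 2 * \<zeta> * w" using phi_crescent_quadratic[of \<zeta>] by (simp add: w_def algebra_simps)
  hence "(norm (w\<^sup>2 - 1))\<^sup>2 = 4 * (norm w)\<^sup>2" by (simp add: norm_mult \<zeta> power_mult_distrib)
  moreover have "Re (w\<^sup>2 - 1) = x\<^sup>2 - y\<^sup>2 - 1" "Im (w\<^sup>2 - 1) = 2 * x * y"
    by (simp_all add: x_def y_def power2_eq_square)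
  ultimately have "(x\<^sup>2 - y\<^sup>2 - 1)\<^sup>2 + (2 * x * y)\<^sup>2 = 4 * (x\<^sup>2 + y\<^sup>2)"
    by (simp only: cmod_power2 flip: x_def y_def)
  \<comment> \<open>The equation norm (w^2 - 1) = 2 norm w splits into the two circles of radius
    \<open>sqrt 2\<close> about 1 and -1. The first passes the disc test, the second lies beyond the
    strip.\<close>
  hence "((x - 1)\<^sup>2 + y\<^sup>2 - 2) * ((x + 1)\<^sup>2 + y\<^sup>2 - 2) = 0"
    by (simp add: power2_eq_square algebra_simps)
  hence "(x - 1)\<^sup>2 + y\<^sup>2 = 2 \<or> (x + 1)\<^sup>2 + y\<^sup>2 = 2" by auto
  thus "5 / 4 * (2 - sqrt 2) \<le> norm (phi_crescent \<zeta> - 1) \<or>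
      (2 - sqrt 2) ^ 4 \<le> (2 - sqrt 2) ^ 3 * \<bar>Re (phi_crescent \<zeta> - 1)\<bar> + 3 / 10 * Im (phi_crescent \<zeta> - 1) ^ 4"
  proof
    assume "(x - 1)\<^sup>2 + y\<^sup>2 = 2"
    hence "norm (phi_crescent \<zeta> - 1) = sqrt 2"
      by (simp add: cmod_def x_def y_def w_def)
    thus ?thesis using r by simp
  next
    assume "(x + 1)\<^sup>2 + y\<^sup>2 = 2"
    hence "x + 1 \<le> sqrt 2" by (intro real_le_rsqrt) (smt (verit) zero_le_power2)
    hence "2 - sqrt 2 \<le> \<bar>Re (phi_crescent \<zeta> - 1)\<bar>" by (simp add: x_def w_def)
    thus ?thesis using r by (intro disjI2 quartic_if_strip) auto
  qed
qed (auto simp: phi_crescent_def)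

lemma phi_R_majorant: "oval_majorant phi_R (1 / (3 + 2 * sqrt 2))"
proof -
  define k where "k = 1 + sqrt 2"
  \<comment> \<open>Since k is the positive root of k^2 = 2 k + 1, one gets k^2 = 3 + 2 sqrt 2, and
    the numerators below factor exactly.\<close>
  have k: "2 < k" "k\<^sup>2 = 2 * k + 1" using sqrt_2_bounds by (auto simp: k_def power2_eq_square algebra_simps)
  have \<delta>: "1 / (3 + 2 * sqrt 2) = 1 / k\<^sup>2" unfolding k(2) by (simp add: k_def)
  have phi: "phi_R z = 1 + z * (of_real k + z) / (of_real k * (of_real k - z))" for z
    by (simp add: phi_R_def k_def Let_def)
  have nz: "of_real k - z \<noteq> 0" if "norm z \<le> 1" for z :: complex
    using that k by auto
  show ?thesis
    unfolding \<delta>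
  proof
    show "0 < 1 / k\<^sup>2" using k by simp
    show "phi_R holomorphic_on unit_disc"
      unfolding phi[abs_def] using k nz by (intro holomorphic_intros) auto
    show "continuous_on (cball 0 1) phi_R"
      unfolding phi[abs_def] using k nz by (intro continuous_intros) auto
    show "inj_on phi_R unit_disc"
    proof (rule inj_onI)
      fix a b assume ab: "a \<in> unit_disc" "b \<in> unit_disc" and eq: "phi_R a = phi_R b"
      have nzab: "of_real k - a \<noteq> 0" "of_real k - b \<noteq> 0" using nz ab by auto
      have "a * (of_real k + a) * (of_real k - b) = b * (of_real k + b) * (of_real k - a)"
        using eq k nzab unfolding phi by (simp add: frac_eq_eq mult.assoc)
      hence "(a - b) * (of_real k ^ 2 + of_real k * (a + b) - a * b) = 0"
        by (simp add: power2_eq_square algebra_simps)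
      moreover have "of_real k ^ 2 + of_real k * (a + b) - a * b \<noteq> 0"
      proof
        assume "of_real k ^ 2 + of_real k * (a + b) - a * b = 0"
        hence "of_real (k\<^sup>2) = a * b - of_real k * (a + b)" by (simp add: algebra_simps)
        hence "k\<^sup>2 = norm (a * b - of_real k * (a + b))"
          by (metis norm_of_real abs_power2)
        also have "\<dots> \<le> norm a * norm b + k * norm (a + b)"
          using norm_triangle_ineq4[of "a * b" "of_real k * (a + b)"] k by (simp add: norm_mult)
        also have "norm a * norm b \<le> 1 * 1" using ab by (intro mult_mono) auto
        also have "k * norm (a + b) < k * 2"
          using k ab by (intro mult_strict_left_mono norm_add_less_2) auto
        finally show False using k by simp
      qed
      ultimately show "a = b" by simp
    qed
    show "phi_R (cnj z) = cnj (phi_R z)" for z by (simp add: phi)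
    show "phi_R 0 = 1" by (simp add: phi)
    fix t :: real assume t: "-1 < t" "t < 1"
    have "phi_R (of_real t) = of_real (1 + t * (k + t) / (k * (k - t)))" by (simp add: phi)
    hence re: "Re (phi_R (of_real t)) = 1 + t * (k + t) / (k * (k - t))" by (simp only: Re_complex_of_real)
    have "t * (k + t) / (k * (k - t)) + 1 / k\<^sup>2 = (k * (t * (k + t)) + (k - t)) / (k\<^sup>2 * (k - t))"
    proof -
      have "k \<noteq> 0" "k - t \<noteq> 0" using k t by auto
      thus ?thesis by (simp add: add_divide_distrib power2_eq_square)
    qed
    also have "k * (t * (k + t)) + (k - t) = t * k\<^sup>2 + k * t\<^sup>2 + k - t"
      by (simp add: power2_eq_square algebra_simps)
    also have "\<dots> = k * (t + 1)\<^sup>2" unfolding k(2) by (simp add: power2_eq_square algebra_simps)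
    also have "k * (t + 1)\<^sup>2 / (k\<^sup>2 * (k - t)) \<ge> 0" using k t by simp
    finally show "1 - 1 / k\<^sup>2 \<le> Re (phi_R (of_real t))" unfolding re by simp
  next
    fix \<zeta> :: complex assume \<zeta>: "norm \<zeta> = 1"
    define c where "c = Re \<zeta>"
    have s2: "(Im \<zeta>)\<^sup>2 = 1 - c\<^sup>2" using \<zeta> cmod_power2[of \<zeta>] by (simp add: c_def)
    have c: "-1 \<le> c" "c \<le> 1" using abs_Re_le_cmod[of \<zeta>] \<zeta> by (auto simp: c_def)
    define \<psi> where "\<psi> = phi_R \<zeta> - 1"
    have \<psi>: "\<psi> = \<zeta> * (of_real k + \<zeta>) / (of_real k * (of_real k - \<zeta>))" by (simp add: \<psi>_def phi)
    have nk: "norm (of_real k - \<zeta>) ^ 2 = k\<^sup>2 + 1 - 2 * k * c"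
      unfolding cmod_power2 using s2 by (simp add: c_def power2_eq_square algebra_simps)
    have nk0: "0 < norm (of_real k - \<zeta>)" using nz \<zeta> by simp
    have "5 / 4 * (1 / k\<^sup>2) \<le> norm \<psi> \<or>
      (1 / k\<^sup>2) ^ 4 \<le> (1 / k\<^sup>2) ^ 3 * \<bar>Re \<psi>\<bar> + 3 / 10 * Im \<psi> ^ 4"
    \<comment> \<open>The real part plus \<delta> has the sign of (c + 1)(k c - 1). If k c > 1, then
      c > 0, so norm (k + \<zeta>) >= norm (k - \<zeta>) and the disc test applies.\<close>
    proof (cases "k * c \<le> 1")
      case True
      define N where "N = k\<^sup>2 + 1 - 2 * k * c"
      have N: "0 < N" using nk0 unfolding N_def nk[symmetric] by simp
      have "\<psi> * of_real (k * N) = \<zeta> * (of_real k + \<zeta>) * cnj (of_real k - \<zeta>)"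
      proof -
        have "of_real N = (of_real k - \<zeta>) * cnj (of_real k - \<zeta>)"
          unfolding N_def nk[symmetric] by (rule complex_norm_square)
        moreover have "z / (K * W) * (K * (W * C)) = z * C" if "K \<noteq> 0" "W \<noteq> 0" for z K W C :: complex
          using that by simp
        ultimately show ?thesis unfolding \<psi> of_real_mult using nz[of \<zeta>] \<zeta> k by simp
      qed
      hence "Re (\<psi> * of_real (k * N)) = Re (\<zeta> * (of_real k + \<zeta>) * cnj (of_real k - \<zeta>))" by simp
      moreover have "Re (\<psi> * of_real (k * N)) = Re \<psi> * (k * N)" by simp
      moreover have "Re (\<zeta> * (of_real k + \<zeta>) * cnj (of_real k - \<zeta>)) =
          c * k\<^sup>2 - k * (c\<^sup>2 + (Im \<zeta>)\<^sup>2) + k * (c\<^sup>2 - (Im \<zeta>)\<^sup>2) - c * (c\<^sup>2 + (Im \<zeta>)\<^sup>2)"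
        by (simp add: c_def power2_eq_square algebra_simps)
      hence "Re (\<zeta> * (of_real k + \<zeta>) * cnj (of_real k - \<zeta>)) = 2 * k * (c\<^sup>2 + c - 1)"
        unfolding s2 k(2) by (simp add: algebra_simps)
      ultimately have re: "Re \<psi> * (k * N) = 2 * k * (c\<^sup>2 + c - 1)" by simp
      have "Re \<psi> * N = 2 * (c\<^sup>2 + c - 1)" using re k by simp
      moreover have "(Re \<psi> + 1 / K) * (K * N) = K * (Re \<psi> * N) + N" if "K \<noteq> 0" for K
        using that by (simp add: distrib_right)
      ultimately have "(Re \<psi> + 1 / k\<^sup>2) * (k\<^sup>2 * N) = 2 * (k\<^sup>2 * (c\<^sup>2 + c - 1)) + N"
        using k(1) by simp
      also have "\<dots> = 2 * k * ((c + 1) * (k * c - 1)) - (k\<^sup>2 - 2 * k - 1)"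
        by (simp add: N_def power2_eq_square algebra_simps)
      also have "\<dots> = 2 * k * ((c + 1) * (k * c - 1))" using k by simp
      also have "\<dots> \<le> 0" using True c k by (intro mult_nonneg_nonpos) auto
      finally have "Re \<psi> + 1 / k\<^sup>2 \<le> 0" using N k by (auto simp: mult_le_0_iff)
      hence "1 / k\<^sup>2 \<le> \<bar>Re \<psi>\<bar>" by linarith
      thus ?thesis using k by (intro disjI2 quartic_if_strip) auto
    next
      case False
      hence "0 < c" using k by (smt (verit) mult_nonneg_nonpos)
      have "norm (of_real k - \<zeta>) ^ 2 \<le> norm (of_real k + \<zeta>) ^ 2"
        unfolding cmod_power2 using \<open>0 < c\<close> k
        by (simp add: c_def[symmetric] power2_eq_square algebra_simps)
      hence "norm (of_real k - \<zeta>) \<le> norm (of_real k + \<zeta>)" by (rule power2_le_imp_le) simp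
      hence "1 / k \<le> norm \<psi>"
        using nk0 k unfolding \<psi> norm_divide norm_mult \<zeta> by (simp add: divide_simps)
      moreover have "5 / 4 * (1 / k\<^sup>2) \<le> 1 / k"
        using k by (simp add: divide_simps power2_eq_square)
      ultimately show ?thesis by simp
    qed
    thus "5 / 4 * (1 / k\<^sup>2) \<le> norm (phi_R \<zeta> - 1) \<or>
      (1 / k\<^sup>2) ^ 4 \<le> (1 / k\<^sup>2) ^ 3 * \<bar>Re (phi_R \<zeta> - 1)\<bar> + 3 / 10 * Im (phi_R \<zeta> - 1) ^ 4"
      unfolding \<psi>_def .
  qed
qed

theorem corollary5p1:
  "(\<forall>(\<beta>::real). \<forall>f\<in>class_A. beta_expr \<beta> f \<prec>\<^sub>D phi_Ne \<longrightarrow>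
          (\<beta> \<ge> 8 / (9 * (2 - sqrt 2)) \<longrightarrow> f \<in> starlike_class phi_crescent) \<and>
          (\<beta> \<ge> 4 / 3 \<longrightarrow> f \<in> starlike_C) \<and>
          (\<beta> \<ge> 16 / (9 * (2 * sqrt 2 - 1)) \<longrightarrow> f \<in> starlike_lim) \<and>
          (\<beta> \<ge> 8 * exp 1 / (9 * (exp 1 - 1)) \<longrightarrow> f \<in> starlike_e) \<and>
          (\<beta> \<ge> 8 / (9 * sin 1) \<longrightarrow> f \<in> starlike_S) \<and>
          (\<beta> \<ge> 8 / 9 * (3 + 2 * sqrt 2) \<longrightarrow> f \<in> starlike_R) \<and>
          (\<beta> \<ge> 4 / 3 \<longrightarrow> f \<in> starlike_Ne)) \<and>
     (\<forall>b::real. b < 8 / (9 * (2 - sqrt 2)) \<longrightarrow>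
        (\<exists>\<beta>\<ge>b. \<exists>f\<in>class_A. beta_expr \<beta> f \<prec>\<^sub>D phi_Ne \<and> f \<notin> starlike_class phi_crescent)) \<and>
     (\<forall>b::real. b < 4 / 3 \<longrightarrow>
        (\<exists>\<beta>\<ge>b. \<exists>f\<in>class_A. beta_expr \<beta> f \<prec>\<^sub>D phi_Ne \<and> f \<notin> starlike_C)) \<and>
     (\<forall>b::real. b < 16 / (9 * (2 * sqrt 2 - 1)) \<longrightarrow>
        (\<exists>\<beta>\<ge>b. \<exists>f\<in>class_A. beta_expr \<beta> f \<prec>\<^sub>D phi_Ne \<and> f \<notin> starlike_lim)) \<and>
     (\<forall>b::real. b < 8 * exp 1 / (9 * (exp 1 - 1)) \<longrightarrow>
        (\<exists>\<beta>\<ge>b. \<exists>f\<in>class_A. beta_expr \<beta> f \<prec>\<^sub>D phi_Ne \<and> f \<notin> starlike_e)) \<and>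
     (\<forall>b::real. b < 8 / (9 * sin 1) \<longrightarrow>
        (\<exists>\<beta>\<ge>b. \<exists>f\<in>class_A. beta_expr \<beta> f \<prec>\<^sub>D phi_Ne \<and> f \<notin> starlike_S)) \<and>
     (\<forall>b::real. b < 8 / 9 * (3 + 2 * sqrt 2) \<longrightarrow>
        (\<exists>\<beta>\<ge>b. \<exists>f\<in>class_A. beta_expr \<beta> f \<prec>\<^sub>D phi_Ne \<and> f \<notin> starlike_R)) \<and>
     (\<forall>b::real. b < 4 / 3 \<longrightarrow>
        (\<exists>\<beta>\<ge>b. \<exists>f\<in>class_A. beta_expr \<beta> f \<prec>\<^sub>D phi_Ne \<and> f \<notin> starlike_Ne))"
proof -
  have eqs: "8 / (9 * (2 / 3)) = (4 / 3 :: real)"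
    "8 / (9 * (sqrt 2 - 1 / 2)) = 16 / (9 * (2 * sqrt 2 - 1))"
    "8 / (9 * (1 - exp (- 1))) = 8 * exp 1 / (9 * (exp 1 - 1 :: real))"
    "8 / (9 * (1 / (3 + 2 * sqrt 2))) = 8 / 9 * (3 + 2 * sqrt 2)"
    using sqrt_2_bounds by (auto simp: exp_minus field_simps)
  note majorants = phi_crescent_majorant phi_C_majorant phi_lim_majorant exp_majorant
    phi_sin_majorant phi_R_majorant phi_Ne_majorant
  note starlike = majorants[THEN oval_majorant.starlike, unfolded eqs]
  note sharp = majorants[THEN oval_majorant.sharp, unfolded eqs]
  show ?thesis
    by (intro conjI allI ballI impI; rule starlike sharp; assumption)
qed

end
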